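(* Assume the mismatched problem (P) and the standing assumption (SA) described in the context. Let $\varepsilon\in\left]0,\chi/2\right[$, let $(\gamma_n)_{n\in\mathbb{N}}$ be a sequence in $[\varepsilon,\chi-\varepsilon]$, let $z_0\in\mathcal{H}$, and let $(z_n)_{n\in\mathbb{N}}$ be generated by, for every $n\in\mathbb{N}$, $$u_n=D_{K_n}z_n,\qquad y_n=z_n-\gamma_n(Cz_n+u_n),\qquad x_n=J_{\gamma_nA}(y_n),\qquad z_{n+1}=x_n+\gamma_n(u_n-D_{K_n}x_n).$$ Then the following hold. (i) $(z_n)_{n\in\mathbb{N}}$ converges weakly to some solution to (P), i.e., to some point of $\mathrm{zer}(A+C+D_K)$. (ii) If $\hat\rho>0$ and there exists $\overline{\eta}\in[0,1[$ such that, for every $n\in\mathbb{N}$, $\omega_n=\omega_0\,\overline{\eta}^n$, then $(z_n)_{n\in\mathbb{N}}$ converges linearly to the unique solution to (P).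
   Context: $\mathcal{H}$ and $\mathcal{G}$ are real Hilbert spaces; $\mathcal{B}(\mathcal{G},\mathcal{H})$ is the set of bounded linear operators from $\mathcal{G}$ to $\mathcal{H}$. For $\rho\in\mathbb{R}$, $A:\mathcal{H}\to2^{\mathcal{H}}$ is $\rho$-monotone if $\langle x-y\mid u-v\rangle\ge\rho\|x-y\|^2$ for all $(x,u),(y,v)$ in the graph of $A$, and maximally $\rho$-monotone if moreover its graph is maximal for inclusion among graphs of $\rho$-monotone operators. $C:\mathcal{H}\to\mathcal{H}$ is $\beta$-cocoercive if $\langle x-y\mid Cx-Cy\rangle\ge\beta\|Cx-Cy\|^2$ for all $x,y$. $\operatorname{Lip}T$ is the smallest Lipschitz constant of $T$. $\mathrm{zer}\,A=\{x: 0\in Ax\}$. The resolvent is $J_A=(\mathrm{Id}+A)^{-1}$; it is single valued when $A$ is maximally $\rho$-monotone with $\rho>-1$. Problem (P): $A:\mathcal{H}\to2^{\mathcal{H}}$ is maximally $\rho$-monotone for some $\rho\in\mathbb{R}$, $C:\mathcal{H}\to\mathcal{H}$ is $\beta$-cocoercive for some $\beta\in\left]0,+\infty\right[$, $B:\mathcal{G}\to\mathcal{G}$ is monotone and $\zeta$-Lipschitzian for some $\zeta\in\left]0,+\infty\right[$, $L:\mathcal{H}\to\mathcal{G}$ and $K:\mathcal{G}\to\mathcal{H}$ are bounded linear operators, $c\in\mathcal{G}$, $\alpha\in[0,+\infty[$. Find $x\in\mathcal{H}$ such that $0\in Ax+Cx+\alpha K(Lx-c)+KBLx$, under the assumption that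 the set of solutions is nonempty. Notation: for $M\in\mathcal{B}(\mathcal{G},\mathcal{H})$, $D_M:x\mapsto\alpha M(Lx-c)+MBLx$, $\kappa_M=\operatorname{Lip}(M(\alpha\,\mathrm{Id}_{\mathcal{G}}+B)L)$, $\widetilde\zeta_M=\operatorname{Lip}(MBL)$; $\lambda_{\min}=\inf\{\langle x\mid KLx\rangle : x\in\mathcal{H},\ \|x\|=1\}$; $\hat\rho=\rho+\alpha\lambda_{\min}-\widetilde\zeta_{L^*-K}$. Standing assumption (SA): $D_K\neq0$; $\hat\rho\ge0$; $(K_n)_{n\in\mathbb{N}}$ is a sequence in $\mathcal{B}(\mathcal{G},\mathcal{H})$ such that $\|K_n-K\|\le\omega_n$ for every $n\in\mathbb{N}$, where $\{\omega_n\}_{n\in\mathbb{N}}\subset[0,+\infty[$ and $\sum_{n}\omega_n<+\infty$. The constant $\chi$ is $\chi=\frac{4\beta}{1+\sqrt{1+16\beta^2\kappa_K^2}}$ if $\rho\ge0$, and $\chi=\min\left\{\frac{4\beta}{1+\sqrt{1+16\beta^2\kappa_K^2}},-\frac1\rho\right\}$ otherwise. A sequence $(z_n)$ converges linearly to $z$ if there exist $R\ge0$ and $r\in\left]0,1\right[$ such that $\|z_n-z\|\le R\,r^n$ for all $n$ (large enough). *)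

theory Defs
  imports "HOL-Analysis.Analysis"
begin

text \<open>
  A real Hilbert space is a type of sort \<open>{real_inner, complete_space}\<close>; a set-valued operator
  \<open>A : H \<rightarrow> 2\<^sup>H\<close> is a function \<open>'h \<Rightarrow> 'h set\<close>.
\<close>

definition graph_of :: "('h \<Rightarrow> 'h set) \<Rightarrow> ('h \<times> 'h) set" where
  "graph_of A = {(x, u). u \<in> A x}"

definition rho_monotone :: "real \<Rightarrow> ('h::real_inner \<Rightarrow> 'h set) \<Rightarrow> bool" where
  "rho_monotone \<rho> A \<longleftrightarrow>
     (\<forall>(x, u) \<in> graph_of A. \<forall>(y, v) \<in> graph_of A. (x - y) \<bullet> (u - v) \<ge> \<rho> * (norm (x - y))\<^sup>2)"

definition maximally_rho_monotone :: "real \<Rightarrow> ('h::real_inner \<Rightarrow> 'h set) \<Rightarrow> bool" where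
  "maximally_rho_monotone \<rho> A \<longleftrightarrow>
     rho_monotone \<rho> A \<and>
     (\<forall>A'. rho_monotone \<rho> A' \<and> graph_of A \<subseteq> graph_of A' \<longrightarrow> graph_of A' = graph_of A)"

definition monotone_single :: "('g::real_inner \<Rightarrow> 'g) \<Rightarrow> bool" where
  "monotone_single B \<longleftrightarrow> (\<forall>x y. (x - y) \<bullet> (B x - B y) \<ge> 0)"

definition cocoercive :: "real \<Rightarrow> ('h::real_inner \<Rightarrow> 'h) \<Rightarrow> bool" where
  "cocoercive \<beta> C \<longleftrightarrow> (\<forall>x y. (x - y) \<bullet> (C x - C y) \<ge> \<beta> * (norm (C x - C y))\<^sup>2)"

text \<open>The infimum is attained, hence is the smallest Lipschitz constant, as soon as \<open>T\<close> is
  Lipschitz continuous (the value is unspecified otherwise).\<close>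

definition Lip :: "('a::metric_space \<Rightarrow> 'b::metric_space) \<Rightarrow> real" where
  "Lip T = Inf {k. k-lipschitz_on UNIV T}"

definition scale_op :: "real \<Rightarrow> ('h::real_vector \<Rightarrow> 'h set) \<Rightarrow> 'h \<Rightarrow> 'h set" where
  "scale_op \<gamma> A = (\<lambda>x. (\<lambda>u. \<gamma> *\<^sub>R u) ` A x)"

definition add_op :: "('h::real_vector \<Rightarrow> 'h set) \<Rightarrow> ('h \<Rightarrow> 'h) \<Rightarrow> 'h \<Rightarrow> 'h set" where
  "add_op A T = (\<lambda>x. (\<lambda>u. u + T x) ` A x)"

definition zer :: "('h::real_vector \<Rightarrow> 'h set) \<Rightarrow> 'h set" where
  "zer A = {x. 0 \<in> A x}"

text \<open>\<open>J\<^sub>A = (Id + A)\<^sup>-\<^sup>1\<close> as a set-valued inverse; it has exactly one value at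
  each point if \<open>A\<close> is maximally \<open>\<rho>\<close>-monotone with \<open>\<rho> > -1\<close>, and \<open>the_elem\<close> then gives the single-valued
  resolvent.\<close>

definition resolvent :: "('h::real_vector \<Rightarrow> 'h set) \<Rightarrow> 'h \<Rightarrow> 'h set" where
  "resolvent A y = {x. y \<in> add_op A (\<lambda>x. x) x}"

text \<open>\<open>mismatch_op \<alpha> L B c M\<close> is \<open>D\<^sub>M\<close>. Here and below \<open>M\<close> is a plain function, so that \<open>M\<close> can
  be the difference of \<open>adjoint L\<close> and \<open>K\<close>.\<close>

definition mismatch_op ::
    "real \<Rightarrow> ('h::real_normed_vector \<Rightarrow>\<^sub>L 'g::real_normed_vector) \<Rightarrow> ('g \<Rightarrow> 'g) \<Rightarrow> 'g
      \<Rightarrow> ('g \<Rightarrow> 'h) \<Rightarrow> 'h \<Rightarrow> 'h" where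
  "mismatch_op \<alpha> L B c M = (\<lambda>x. \<alpha> *\<^sub>R M (L x - c) + M (B (L x)))"

definition kappa ::
    "real \<Rightarrow> ('h::real_normed_vector \<Rightarrow>\<^sub>L 'g::real_normed_vector) \<Rightarrow> ('g \<Rightarrow> 'g)
      \<Rightarrow> ('g \<Rightarrow> 'h) \<Rightarrow> real" where
  "kappa \<alpha> L B M = Lip (\<lambda>x. M (\<alpha> *\<^sub>R L x + B (L x)))"

definition zeta_tilde ::
    "('h::real_normed_vector \<Rightarrow>\<^sub>L 'g::real_normed_vector) \<Rightarrow> ('g \<Rightarrow> 'g) \<Rightarrow> ('g \<Rightarrow> 'h) \<Rightarrow> real" where
  "zeta_tilde L B M = Lip (\<lambda>x. M (B (L x)))"

text \<open>If \<open>'h\<close> is not trivial, the set is nonempty and bounded below, so that the real \<open>Inf\<close> is the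
  infimum; a trivial \<open>'h\<close> is excluded by \<open>D\<^sub>K \<noteq> 0\<close>.\<close>

definition lambda_min ::
    "('h::real_inner \<Rightarrow>\<^sub>L 'g::real_normed_vector) \<Rightarrow> ('g \<Rightarrow>\<^sub>L 'h) \<Rightarrow> real" where
  "lambda_min L K = Inf {x \<bullet> K (L x) | x. norm x = 1}"

definition rho_hat ::
    "real \<Rightarrow> real \<Rightarrow> ('h::real_inner \<Rightarrow>\<^sub>L 'g::real_inner) \<Rightarrow> ('g \<Rightarrow> 'g) \<Rightarrow> ('g \<Rightarrow>\<^sub>L 'h) \<Rightarrow> real" where
  "rho_hat \<rho> \<alpha> L B K =
     \<rho> + \<alpha> * lambda_min L K - zeta_tilde L B (\<lambda>y. adjoint (blinfun_apply L) y - K y)"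

definition chi :: "real \<Rightarrow> real \<Rightarrow> real \<Rightarrow> real" where
  "chi \<rho> \<beta> \<kappa> =
     (let \<chi>\<^sub>0 = 4 * \<beta> / (1 + sqrt (1 + 16 * \<beta>\<^sup>2 * \<kappa>\<^sup>2))
      in if \<rho> \<ge> 0 then \<chi>\<^sub>0 else min \<chi>\<^sub>0 (- 1 / \<rho>))"

definition converges_weakly :: "(nat \<Rightarrow> 'h::real_inner) \<Rightarrow> 'h \<Rightarrow> bool" where
  "converges_weakly z l \<longleftrightarrow> (\<forall>v. (\<lambda>n. z n \<bullet> v) \<longlonglongrightarrow> l \<bullet> v)"

definition converges_linearly :: "(nat \<Rightarrow> 'h::real_normed_vector) \<Rightarrow> 'h \<Rightarrow> bool" where
  "converges_linearly z l \<longleftrightarrow>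
     (\<exists>R r. R \<ge> 0 \<and> 0 < r \<and> r < 1 \<and> (\<forall>n. norm (z n - l) \<le> R * r ^ n))"

end

theory Submission
  imports Defs "HOL-Library.Diagonal_Subsequence"
begin

text \<open>
  The iteration is a perturbation of the forward-backward-half-forward method run with the exact
  operator \<open>D\<^sub>K\<close>, and both halves of the theorem come from comparing the two.

  Write \<open>D\<close> for \<open>D\<^sub>K\<close>. The operator \<open>D\<close> is \<open>\<kappa>\<^sub>K\<close>-Lipschitzian, and replacing \<open>K\<close> by \<open>L\<^sup>*\<close> in \<open>KBL\<close>
  makes it monotone at the price of an error whose Lipschitz constant is \<open>zeta_tilde\<close>, so that
  \<open>A + D\<close> is \<open>rho_hat\<close>-monotone (\<open>mismatch_op_monotone\<close>). For a solution \<open>s\<close>, one exact step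
  \<open>z \<mapsto> w\<close> with resolvent point \<open>p\<close> then satisfies
  \<open>\<parallel>w - s\<parallel>\<^sup>2 \<le> \<parallel>z - s\<parallel>\<^sup>2 - \<delta>\<parallel>p - z\<parallel>\<^sup>2 - 2\<gamma>\<sigma>\<parallel>p - s\<parallel>\<^sup>2\<close> (\<open>forward_backward_half_forward_step\<close>),
  where \<open>\<sigma>\<close> is \<open>rho_hat\<close> and the bound \<open>\<chi>\<close> on the step sizes is what makes \<open>\<delta>\<close> positive
  (\<open>chi_margin\<close>) and the resolvents uniformly Lipschitzian (\<open>chi_resolvent_margin\<close>). Using \<open>K\<^sub>n\<close>
  in place of \<open>K\<close> displaces the step by at most \<open>\<omega>\<^sub>n M (1 + \<parallel>z\<^sub>n - s\<parallel>)\<close> (\<open>perturbed_step_error\<close>).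

  Weak convergence: the error being summable, \<open>\<parallel>z\<^sub>n - s\<parallel>\<close> converges for every solution \<open>s\<close> and
  \<open>p\<^sub>n - z\<^sub>n \<rightarrow> 0\<close> (\<open>quasi_fejer\<close>). Hence the points \<open>p\<^sub>n\<close> are approximate zeros of \<open>A + C + D\<close>,
  and their weak cluster points are zeros (\<open>weak_limit_of_resolvent_points\<close>). Opial's argument
  concludes. Linear convergence: if \<open>\<sigma> > 0\<close>, then the exact step is a uniform contraction towards
  \<open>s\<close>, and a contraction perturbed by a geometric sequence still decays geometrically
  (\<open>geometric_perturbation_decay\<close>).

  Three facts on Hilbert spaces are needed: the Riesz representation (for the adjoint of \<open>L\<close> and
  for weak limits), weak sequential compactness of bounded sequences, and Minty's theorem, which
  makes the resolvents defined everywhere. The first and the third, as well as orthogonal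
  projections, are all instances of one minimisation principle, \<open>quadratic_minimum_over_epigraph\<close>.
\<close>

section \<open>Minimisation, Riesz representation and orthogonal decomposition\<close>

text \<open>
  The function \<open>(x, m) \<mapsto> m + \<parallel>x\<parallel>\<^sup>2/2\<close> is strongly convex in \<open>x\<close>, so by the parallelogram law its
  minimising sequences on a convex set are Cauchy, hence converge. The conclusion is the
  first-order optimality condition, \<open>-x\<close> being a subgradient at \<open>x\<close> of the function with epigraph
  \<open>E\<close>.
\<close>

lemma quadratic_minimum_over_epigraph:
  fixes E :: "('a::{real_inner, complete_space} \<times> real) set"
  assumes cl: "closed E" and cv: "convex E" and ne: "E \<noteq> {}"
    and lb: "\<And>x m. (x, m) \<in> E \<Longrightarrow> b \<le> m + (norm x)\<^sup>2 / 2"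
  obtains x m where "(x, m) \<in> E" "\<And>p q. (p, q) \<in> E \<Longrightarrow> m + (norm x)\<^sup>2 \<le> q + x \<bullet> p"
proof -
  define \<phi> where "\<phi> = (\<lambda>e::'a \<times> real. snd e + (norm (fst e))\<^sup>2 / 2)"
  define \<mu> where "\<mu> = Inf (\<phi> ` E)"
  have bdd: "bdd_below (\<phi> ` E)"
    by (rule bdd_belowI[of _ b]) (use lb in \<open>auto simp: \<phi>_def\<close>)
  have low: "\<mu> \<le> \<phi> e" if "e \<in> E" for e
    unfolding \<mu>_def using bdd that by (simp add: cINF_lower)
  have "\<exists>e\<in>E. \<phi> e < \<mu> + 1 / real (Suc n)" for n
  proof -
    have "Inf (\<phi> ` E) < \<mu> + 1 / real (Suc n)"
      by (simp add: \<mu>_def)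
    then show ?thesis
      using cInf_lessD[of "\<phi> ` E"] ne by blast
  qed
  then obtain e where eE: "\<And>n. e n \<in> E" and e: "\<And>n. \<phi> (e n) < \<mu> + 1 / real (Suc n)"
    by metis
  have mid: "(norm (fst f - fst g))\<^sup>2 \<le> 4 * (\<phi> f + \<phi> g - 2 * \<mu>)" if "f \<in> E" "g \<in> E" for f g
  proof -
    have "(1/2) *\<^sub>R f + (1/2) *\<^sub>R g \<in> E"
      using cv that by (intro convexD) auto
    from low[OF this]
    have "\<mu> \<le> (snd f + snd g) / 2 + (norm ((1/2) *\<^sub>R fst f + (1/2) *\<^sub>R fst g))\<^sup>2 / 2"
      by (simp add: \<phi>_def add_divide_distrib)
    moreover have "(norm ((1/2) *\<^sub>R fst f + (1/2) *\<^sub>R fst g))\<^sup>2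
        = ((norm (fst f))\<^sup>2 + (norm (fst g))\<^sup>2) / 2 - (norm (fst f - fst g))\<^sup>2 / 4"
      unfolding power2_norm_eq_inner
      by (simp add: inner_add_left inner_add_right inner_diff_left inner_diff_right inner_commute
          field_simps)
    ultimately show ?thesis
      by (simp add: \<phi>_def field_simps)
  qed
  have "Cauchy (\<lambda>n. fst (e n))"
  proof (rule metric_CauchyI)
    fix \<epsilon> :: real assume "0 < \<epsilon>"
    then obtain N where N: "1 / real (Suc N) < \<epsilon>\<^sup>2 / 8"
      using nat_approx_posE[of "\<epsilon>\<^sup>2 / 8"] by auto
    have "dist (fst (e i)) (fst (e j)) < \<epsilon>" if "i \<ge> N" "j \<ge> N" for i j
    proof -
      have "\<phi> (e k) < \<mu> + \<epsilon>\<^sup>2 / 8" if "k \<ge> N" for k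
      proof -
        have "1 / real (Suc k) \<le> 1 / real (Suc N)"
          using that by (auto simp: field_simps)
        also note N
        finally have "\<mu> + 1 / real (Suc k) < \<mu> + \<epsilon>\<^sup>2 / 8" by (rule add_strict_left_mono)
        with e[of k] show ?thesis by (rule order.strict_trans)
      qed
      from this[OF that(1)] this[OF that(2)] have "(norm (fst (e i) - fst (e j)))\<^sup>2 < \<epsilon>\<^sup>2"
        using mid[OF eE[of i] eE[of j]] by (simp add: field_simps)
      then show ?thesis
        unfolding dist_norm by (rule power_less_imp_less_base) (use \<open>0 < \<epsilon>\<close> in simp)
    qed
    then show "\<exists>M. \<forall>m\<ge>M. \<forall>n\<ge>M. dist (fst (e m)) (fst (e n)) < \<epsilon>" by blast
  qed
  then obtain x where x: "(\<lambda>n. fst (e n)) \<longlonglongrightarrow> x"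
    using Cauchy_convergent_iff convergent_def by blast
  have "(\<lambda>n. \<phi> (e n)) \<longlonglongrightarrow> \<mu>"
  proof (rule tendsto_sandwich)
    show "\<forall>\<^sub>F n in sequentially. \<mu> \<le> \<phi> (e n)" using low eE by simp
    show "\<forall>\<^sub>F n in sequentially. \<phi> (e n) \<le> \<mu> + 1 / real (Suc n)"
      using e by (intro always_eventually allI less_imp_le) auto
    show "(\<lambda>n. \<mu> + 1 / real (Suc n)) \<longlonglongrightarrow> \<mu>"
      using tendsto_add[OF tendsto_const LIMSEQ_Suc[OF lim_1_over_n], of \<mu>] by simp
  qed simp
  then have "(\<lambda>n. \<phi> (e n) - (norm (fst (e n)))\<^sup>2 / 2) \<longlonglongrightarrow> \<mu> - (norm x)\<^sup>2 / 2"
    by (intro tendsto_diff tendsto_divide tendsto_power tendsto_norm tendsto_const x) auto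
  then have "(\<lambda>n. snd (e n)) \<longlonglongrightarrow> \<mu> - (norm x)\<^sup>2 / 2" by (simp add: \<phi>_def)
  with x have "(\<lambda>n. (fst (e n), snd (e n))) \<longlonglongrightarrow> (x, \<mu> - (norm x)\<^sup>2 / 2)"
    by (rule tendsto_Pair)
  then have "e \<longlonglongrightarrow> (x, \<mu> - (norm x)\<^sup>2 / 2)" by simp
  then have xE: "(x, \<mu> - (norm x)\<^sup>2 / 2) \<in> E"
    using closed_sequentially[OF cl] eE by blast
  have "\<mu> - (norm x)\<^sup>2 / 2 + (norm x)\<^sup>2 \<le> q + x \<bullet> p" if pq: "(p, q) \<in> E" for p q
  proof -
    have expand: "(norm (x + t *\<^sub>R d))\<^sup>2 = (norm x)\<^sup>2 + 2 * (t * (x \<bullet> d)) + t * (t * (norm d)\<^sup>2)"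
      for t d
      unfolding power2_norm_eq_inner by (simp add: inner_add_left inner_add_right inner_commute)
    define m where "m = \<mu> - (norm x)\<^sup>2 / 2"
    have \<mu>: "\<mu> = m + (norm x)\<^sup>2 / 2" by (simp add: m_def)
    have "- (t * ((norm (p - x))\<^sup>2 / 2)) \<le> (q - m) + x \<bullet> (p - x)" if t: "0 < t" "t \<le> 1" for t
    proof -
      have "(1 - t) *\<^sub>R (x, m) + t *\<^sub>R (p, q) \<in> E"
        using cv pq xE t by (intro convexD) (auto simp: m_def)
      from low[OF this] have "0 \<le> t * (q - m) + ((norm (x + t *\<^sub>R (p - x)))\<^sup>2 / 2 - (norm x)\<^sup>2 / 2)"
        by (simp add: \<phi>_def \<mu> algebra_simps)
      also have "(norm (x + t *\<^sub>R (p - x)))\<^sup>2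
          = (norm x)\<^sup>2 + 2 * (t * (x \<bullet> (p - x))) + t * (t * (norm (p - x))\<^sup>2)"
        by (rule expand)
      also have "t * (q - m) + (((norm x)\<^sup>2 + 2 * (t * (x \<bullet> (p - x))) + t * (t * (norm (p - x))\<^sup>2)) / 2
          - (norm x)\<^sup>2 / 2) = t * ((q - m) + x \<bullet> (p - x) + t * ((norm (p - x))\<^sup>2 / 2))"
        by (simp add: add_divide_distrib distrib_left)
      finally have "0 \<le> (q - m) + x \<bullet> (p - x) + t * ((norm (p - x))\<^sup>2 / 2)"
        using t by (simp add: zero_le_mult_iff)
      then show ?thesis by linarith
    qed
    then have "\<forall>\<^sub>F t in at_right 0. - (t * ((norm (p - x))\<^sup>2 / 2)) \<le> (q - m) + x \<bullet> (p - x)"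
      by (intro eventually_at_rightI[of 0 1]) auto
    moreover have "((\<lambda>t. - (t * ((norm (p - x))\<^sup>2 / 2))) \<longlongrightarrow> - (0 * ((norm (p - x))\<^sup>2 / 2))) (at_right 0)"
      by (intro tendsto_intros)
    ultimately have "- (0 * ((norm (p - x))\<^sup>2 / 2)) \<le> (q - m) + x \<bullet> (p - x)"
      by (intro tendsto_upperbound) auto
    then show ?thesis
      by (simp add: m_def power2_norm_eq_inner inner_diff_right)
  qed
  with xE show ?thesis by (rule that)
qed

text \<open>
  Minimising \<open>\<parallel>x\<parallel>\<^sup>2/2 - f x\<close>, whose optimality condition bounds the linear functional
  \<open>v \<mapsto> x \<bullet> v - f v\<close> from below, which forces it to vanish.
\<close>

lemma riesz_representation:
  fixes f :: "'a::{real_inner, complete_space} \<Rightarrow> real"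
  assumes "bounded_linear f"
  obtains x where "\<And>v. f v = x \<bullet> v"
proof -
  interpret f: bounded_linear f by fact
  obtain k where k: "\<And>x. \<bar>f x\<bar> \<le> norm x * k"
    using f.bounded by auto
  let ?E = "{(x, m). m = - f x}"
  have "closed {e. snd e = - f (fst e)}"
    by (intro closed_Collect_eq continuous_intros f.continuous_on)
  moreover have "?E = {e. snd e = - f (fst e)}" by auto
  ultimately have "closed ?E" by simp
  moreover have "convex ?E"
    by (auto simp: convex_def f.add f.scaleR algebra_simps)
  moreover have "?E \<noteq> {}" by auto
  moreover have "- (k\<^sup>2 / 2) \<le> m + (norm x)\<^sup>2 / 2" if "(x, m) \<in> ?E" for x m
    using k[of x] that zero_le_power2[of "norm x - k"] by (auto simp: power2_diff algebra_simps)
  ultimately obtain x m where xm: "(x, m) \<in> ?E"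
    and opt: "\<And>p q. (p, q) \<in> ?E \<Longrightarrow> m + (norm x)\<^sup>2 \<le> q + x \<bullet> p"
    by (rule quadratic_minimum_over_epigraph) auto
  define d where "d = m + (norm x)\<^sup>2"
  define g where "g = (\<lambda>v. x \<bullet> v - f v)"
  have g: "d \<le> g v" for v using opt[of v "- f v"] by (simp add: d_def g_def)
  have "g v = 0" for v
  proof (rule ccontr)
    assume "g v \<noteq> 0"
    \<comment> \<open>scale \<open>v\<close> so that \<open>g\<close> drops just below its lower bound \<open>d\<close>\<close>
    have "g (((d - 1) / g v) *\<^sub>R v) = (d - 1) / g v * g v"
      by (simp add: g_def f.scaleR right_diff_distrib)
    also have "\<dots> = d - 1" using \<open>g v \<noteq> 0\<close> by simp
    finally show False using g[of "((d - 1) / g v) *\<^sub>R v"] by simp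
  qed
  then have "\<And>v. f v = x \<bullet> v" by (simp add: g_def)
  then show ?thesis by (rule that)
qed

text \<open>
  The constant \<open>adjoint\<close> is a choice of some operator with this property, so that it means
  something only once such an operator is known to exist.
\<close>

lemma adjoint_inner:
  fixes L :: "'h::{real_inner, complete_space} \<Rightarrow>\<^sub>L 'g::real_inner"
  shows "L x \<bullet> y = x \<bullet> adjoint (blinfun_apply L) y"
proof -
  have "\<exists>w. \<forall>x. L x \<bullet> y = x \<bullet> w" for y
  proof -
    have "bounded_linear (\<lambda>x. L x \<bullet> y)"
      by (rule bounded_linear_compose[OF bounded_linear_inner_left blinfun.bounded_linear_right])
    then show ?thesis
      by (rule riesz_representation) (auto simp: inner_commute)
  qed
  then have "\<exists>f'. \<forall>x y. L x \<bullet> y = x \<bullet> f' y" by metis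
  then have "\<forall>x y. L x \<bullet> y = x \<bullet> adjoint (blinfun_apply L) y"
    unfolding adjoint_def by (rule someI_ex)
  then show ?thesis by blast
qed

lemma bounded_linear_adjoint:
  fixes L :: "'h::{real_inner, complete_space} \<Rightarrow>\<^sub>L 'g::real_inner"
  shows "bounded_linear (adjoint (blinfun_apply L))"
proof (rule bounded_linear_intro[where K = "norm L"])
  let ?T = "adjoint (blinfun_apply L)"
  show "?T (a + b) = ?T a + ?T b" for a b
    by (rule vector_eq_ldot[THEN iffD1]) (simp add: inner_add_right flip: adjoint_inner)
  show "?T (r *\<^sub>R b) = r *\<^sub>R ?T b" for r b
    by (rule vector_eq_ldot[THEN iffD1]) (simp flip: adjoint_inner)
  show "norm (?T y) \<le> norm y * norm L" for y
  proof (cases "norm (?T y) = 0")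
    case False
    have "norm (?T y) * norm (?T y) = L (?T y) \<bullet> y"
      by (simp add: adjoint_inner flip: power2_norm_eq_inner power2_eq_square)
    also have "\<dots> \<le> norm (L (?T y)) * norm y" by (rule norm_cauchy_schwarz)
    also have "\<dots> \<le> (norm L * norm (?T y)) * norm y"
      by (intro mult_right_mono norm_blinfun) auto
    finally have "norm (?T y) * norm (?T y) \<le> norm (?T y) * (norm y * norm L)"
      by (simp add: algebra_simps)
    then show ?thesis using False by (simp add: mult_le_cancel_left)
  next
    case True
    then show ?thesis by (simp only: mult_nonneg_nonneg norm_ge_zero)
  qed
qed

text \<open>
  The vector \<open>q\<close> is the point of minimal norm of the affine subspace \<open>v + V\<close>.
\<close>

lemma orthogonal_decomposition:
  fixes V :: "'a::{real_inner, complete_space} set"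
  assumes "closed V" "subspace V"
  obtains q where "v - q \<in> V" "\<And>w. w \<in> V \<Longrightarrow> q \<bullet> w = 0"
proof -
  let ?E = "{x. v - x \<in> V} \<times> {0::real}"
  have "closed ((\<lambda>x. v - x) -` V)"
    using assms(1) by (intro closed_vimage continuous_intros)
  then have "closed ?E"
    by (simp add: closed_Times vimage_def)
  moreover have "convex {x. v - x \<in> V}"
  proof (rule convexI)
    fix x y :: 'a and s t :: real
    assume *: "x \<in> {x. v - x \<in> V}" "y \<in> {x. v - x \<in> V}" "s + t = 1"
    then have "s *\<^sub>R (v - x) + t *\<^sub>R (v - y) \<in> V"
      using assms(2) by (auto intro!: subspace_add subspace_scale)
    moreover have "s *\<^sub>R (v - x) + t *\<^sub>R (v - y) = v - (s *\<^sub>R x + t *\<^sub>R y)"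
      using *(3) by (simp add: algebra_simps flip: scaleR_left.add)
    ultimately show "s *\<^sub>R x + t *\<^sub>R y \<in> {x. v - x \<in> V}" by simp
  qed
  then have "convex ?E" by (simp add: convex_Times)
  moreover have "?E \<noteq> {}" using subspace_0[OF assms(2)] by (auto intro: exI[of _ v])
  ultimately obtain q m where q: "(q, m) \<in> ?E"
    and opt: "\<And>p r. (p, r) \<in> ?E \<Longrightarrow> m + (norm q)\<^sup>2 \<le> r + q \<bullet> p"
    by (rule quadratic_minimum_over_epigraph[where b = 0]) auto
  have pos: "0 \<le> q \<bullet> w" if "w \<in> V" for w
  proof -
    have "v - (q + w) \<in> V" using q that subspace_diff[OF assms(2), of "v - q" w]
      by (simp add: algebra_simps)
    then show ?thesis
      using opt[of "q + w" 0] q by (auto simp: inner_add_right power2_norm_eq_inner)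
  qed
  have "q \<bullet> w = 0" if "w \<in> V" for w
    using pos[OF that] pos[OF subspace_neg[OF assms(2) that]] by simp
  with q show ?thesis by (intro that) auto
qed

section \<open>Weak sequential compactness and Opial's lemma\<close>

text \<open>
  A diagonal argument over the scalar sequences \<open>n \<mapsto> z n \<bullet> z m\<close>, one for each \<open>m\<close>. The members of
  the sequence itself play the part of a countable dense set of test vectors.
\<close>

lemma bounded_seq_inner_convergent_subseq:
  fixes z :: "nat \<Rightarrow> 'h::real_inner"
  assumes "bounded (range z)"
  obtains r :: "nat \<Rightarrow> nat" where "strict_mono r" "\<And>m. convergent (\<lambda>n. z (r n) \<bullet> z m)"
proof -
  define P where "P = (\<lambda>m s. convergent (\<lambda>n. z (s n) \<bullet> z m))"
  interpret subseqs P
  proof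
    fix m and s :: "nat \<Rightarrow> nat" assume "strict_mono s"
    have "bounded (range (\<lambda>n. z (s n)))"
      using assms by (rule bounded_subset) auto
    then have "bounded ((\<lambda>w. w \<bullet> z m) ` range (\<lambda>n. z (s n)))"
      by (rule bounded_linear_image[OF _ bounded_linear_inner_left])
    then have "bounded (range (\<lambda>n. z (s n) \<bullet> z m))" by (simp add: image_image)
    then show "\<exists>r'. strict_mono r' \<and> P m (s \<circ> r')"
      using bounded_imp_convergent_subsequence[of "\<lambda>n. z (s n) \<bullet> z m"]
      by (auto simp: P_def convergent_def o_def)
  qed
  have *: "P m (diagseq \<circ> ((+) (Suc m)))" for m
    by (rule diagseq_holds) (auto simp: P_def o_def dest: convergent_subseq_convergent)
  then have "convergent (\<lambda>n. z (diagseq n) \<bullet> z m)" for m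
    using convergent_ignore_initial_segment[of "\<lambda>n. z (diagseq n) \<bullet> z m" "Suc m"] *[of m]
    by (simp add: P_def o_def add.commute)
  then show ?thesis using subseq_diagseq by (intro that) auto
qed

lemma closed_subspace_inner_convergent:
  fixes w :: "nat \<Rightarrow> 'h::real_inner"
  assumes "\<And>n. norm (w n) \<le> M"
  shows "subspace {v. convergent (\<lambda>n. w n \<bullet> v)}" (is "subspace ?V")
    and "closed {v. convergent (\<lambda>n. w n \<bullet> v)}"
proof -
  show "subspace ?V"
    by (auto simp: subspace_def inner_add_right intro: convergent_add convergent_mult convergent_const)
  have M: "0 \<le> M" using assms[of 0] norm_ge_zero[of "w 0"] by linarith
  show "closed ?V"
  proof (rule closed_sequential_limits[THEN iffD2], intro allI impI, elim conjE)
    fix v l assume v: "\<forall>k. v k \<in> ?V" and l: "v \<longlonglongrightarrow> l"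
    have "Cauchy (\<lambda>n. w n \<bullet> l)"
    proof (rule metric_CauchyI)
      fix e :: real assume "0 < e"
      then have "0 < e / (3 * (M + 1))" using M by simp
      then obtain k where "norm (v k - l) < e / (3 * (M + 1))"
        using l by (metis LIMSEQ_D order_refl)
      then have k: "norm (v k - l) * (M + 1) < e / 3"
        using M by (simp add: field_simps)
      have near: "\<bar>w n \<bullet> v k - w n \<bullet> l\<bar> < e / 3" for n
      proof -
        have "\<bar>w n \<bullet> (v k - l)\<bar> \<le> norm (w n) * norm (v k - l)" by (rule Cauchy_Schwarz_ineq2)
        also have "\<dots> \<le> (M + 1) * norm (v k - l)"
          using assms[of n] by (intro mult_right_mono) auto
        finally show ?thesis using k by (simp add: inner_diff_right mult.commute)
      qed
      have "Cauchy (\<lambda>n. w n \<bullet> v k)" using v by (auto intro: convergent_Cauchy)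
      then obtain N where N: "\<And>m n. m \<ge> N \<Longrightarrow> n \<ge> N \<Longrightarrow> \<bar>w m \<bullet> v k - w n \<bullet> v k\<bar> < e / 3"
        using metric_CauchyD[of "\<lambda>n. w n \<bullet> v k" "e / 3"] \<open>0 < e\<close> by (auto simp: dist_real_def)
      have "dist (w m \<bullet> l) (w n \<bullet> l) < e" if "m \<ge> N" "n \<ge> N" for m n
        using N[OF that] near[of m] near[of n] unfolding dist_real_def by arith
      then show "\<exists>N. \<forall>m\<ge>N. \<forall>n\<ge>N. dist (w m \<bullet> l) (w n \<bullet> l) < e" by blast
    qed
    then show "l \<in> ?V" by (simp add: Cauchy_convergent_iff)
  qed
qed

text \<open>
  The vectors against which the inner products of the diagonal subsequence converge form a closed
  subspace that contains the sequence. It contains the orthogonal complement of the sequence as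
  well, hence is the whole space, and the limit functional is represented by a vector.
\<close>

lemma bounded_weakly_convergent_subseq:
  fixes z :: "nat \<Rightarrow> 'h::{real_inner, complete_space}"
  assumes "bounded (range z)"
  obtains r :: "nat \<Rightarrow> nat" and s where "strict_mono r" "converges_weakly (z \<circ> r) s"
proof -
  obtain r :: "nat \<Rightarrow> nat" where r: "strict_mono r" and conv: "\<And>m. convergent (\<lambda>n. z (r n) \<bullet> z m)"
    using bounded_seq_inner_convergent_subseq[OF assms] by blast
  obtain M where M: "\<And>n. norm (z n) \<le> M"
    using assms by (auto simp: bounded_iff)
  let ?V = "{v. convergent (\<lambda>n. z (r n) \<bullet> v)}"
  have V: "subspace ?V" "closed ?V"
    using closed_subspace_inner_convergent[of "\<lambda>n. z (r n)" M] M by auto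
  have all: "v \<in> ?V" for v
  proof -
    obtain q where q: "v - q \<in> ?V" "\<And>w. w \<in> ?V \<Longrightarrow> q \<bullet> w = 0"
      using orthogonal_decomposition[OF V(2,1)] by metis
    have "z (r n) \<bullet> q = 0" for n using q(2)[of "z (r n)"] conv by (simp add: inner_commute)
    then have "q \<in> ?V" by (simp add: convergent_const)
    then show ?thesis using subspace_add[OF V(1) q(1), of q] by simp
  qed
  define f where "f = (\<lambda>v. lim (\<lambda>n. z (r n) \<bullet> v))"
  have f: "(\<lambda>n. z (r n) \<bullet> v) \<longlonglongrightarrow> f v" for v
    using all[of v] by (simp add: f_def convergent_LIMSEQ_iff)
  have "bounded_linear f"
  proof (rule bounded_linear_intro[where K = M])
    show "f (v + w) = f v + f w" for v w
      using tendsto_add[OF f[of v] f[of w]] f[of "v + w"]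
      by (simp add: inner_add_right LIMSEQ_unique)
    show "f (t *\<^sub>R v) = t *\<^sub>R f v" for t v
      using tendsto_mult_left[OF f[of v], of t] f[of "t *\<^sub>R v"]
      by (simp add: LIMSEQ_unique)
    show "norm (f v) \<le> norm v * M" for v
    proof (rule LIMSEQ_le_const2[OF tendsto_norm[OF f]], intro exI allI impI)
      fix n
      have "\<bar>z (r n) \<bullet> v\<bar> \<le> norm (z (r n)) * norm v" by (rule Cauchy_Schwarz_ineq2)
      also have "\<dots> \<le> M * norm v" using M by (intro mult_right_mono) auto
      finally show "norm (z (r n) \<bullet> v) \<le> norm v * M" by (simp add: mult.commute)
    qed
  qed
  then obtain s where "\<And>v. f v = s \<bullet> v" by (rule riesz_representation) blast
  with f have "converges_weakly (z \<circ> r) s" by (simp add: converges_weakly_def)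
  with r show ?thesis by (rule that)
qed

text \<open>
  If \<open>s\<close> and \<open>t\<close> are weak cluster points, then \<open>\<parallel>z n - t\<parallel>\<^sup>2 - \<parallel>z n - s\<parallel>\<^sup>2\<close> is affine in
  \<open>z n \<bullet> (s - t)\<close>, so that the latter converges; its limit is both \<open>s \<bullet> (s - t)\<close> and
  \<open>t \<bullet> (s - t)\<close>, and \<open>s = t\<close>.
\<close>

lemma opial_weak_convergence:
  fixes z :: "nat \<Rightarrow> 'h::{real_inner, complete_space}"
  assumes "S \<noteq> {}"
    and dist: "\<And>s. s \<in> S \<Longrightarrow> convergent (\<lambda>n. (norm (z n - s))\<^sup>2)"
    and cluster: "\<And>r s. strict_mono r \<Longrightarrow> converges_weakly (z \<circ> r) s \<Longrightarrow> s \<in> S"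
  shows "\<exists>s\<in>S. converges_weakly z s"
proof -
  obtain s0 where "s0 \<in> S" using \<open>S \<noteq> {}\<close> by blast
  then obtain M where M: "\<And>n. (norm (z n - s0))\<^sup>2 \<le> M"
    using convergent_imp_Bseq[OF dist[of s0]] by (auto simp: Bseq_def)
  have "norm (z n) \<le> norm s0 + sqrt M" for n
    using real_le_rsqrt[OF M[of n]] norm_triangle_ineq[of "z n - s0" s0] by simp
  then have bdd: "bounded (range z)" by (auto simp: bounded_iff)
  have unique: "s = t" if "strict_mono r" "converges_weakly (z \<circ> r) s"
    "strict_mono q" "converges_weakly (z \<circ> q) t" for r q s t
  proof -
    have S: "s \<in> S" "t \<in> S" using cluster that by auto
    have "w \<bullet> (s - t) = (1/2) * ((norm (w - t))\<^sup>2 - (norm (w - s))\<^sup>2 - (norm t)\<^sup>2 + (norm s)\<^sup>2)" for w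
      unfolding power2_norm_eq_inner
      by (simp add: inner_diff_left inner_diff_right inner_commute diff_divide_distrib)
    then have "(\<lambda>n. z n \<bullet> (s - t)) =
        (\<lambda>n. (1/2) * ((norm (z n - t))\<^sup>2 - (norm (z n - s))\<^sup>2 - (norm t)\<^sup>2 + (norm s)\<^sup>2))"
      by (rule ext)
    moreover have "convergent (\<lambda>n. (1/2) * ((norm (z n - t))\<^sup>2 - (norm (z n - s))\<^sup>2 - (norm t)\<^sup>2 + (norm s)\<^sup>2))"
      by (intro convergent_mult convergent_add convergent_diff convergent_const dist S)
    ultimately obtain l where l: "(\<lambda>n. z n \<bullet> (s - t)) \<longlonglongrightarrow> l"
      by (auto simp: convergent_def)
    have "s \<bullet> (s - t) = l"
      using that(2) LIMSEQ_subseq_LIMSEQ[OF l that(1)]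
      by (auto simp: converges_weakly_def o_def intro: LIMSEQ_unique)
    moreover have "t \<bullet> (s - t) = l"
      using that(4) LIMSEQ_subseq_LIMSEQ[OF l that(3)]
      by (auto simp: converges_weakly_def o_def intro: LIMSEQ_unique)
    ultimately have "(s - t) \<bullet> (s - t) = 0" by (simp add: inner_diff_left)
    then show ?thesis by simp
  qed
  obtain r s where r: "strict_mono r" and s: "converges_weakly (z \<circ> r) s"
    using bounded_weakly_convergent_subseq[OF bdd] by blast
  have "(\<lambda>n. z n \<bullet> v) \<longlonglongrightarrow> s \<bullet> v" for v
  proof (rule ccontr)
    assume "\<not> (\<lambda>n. z n \<bullet> v) \<longlonglongrightarrow> s \<bullet> v"
    then obtain e where "0 < e" and "\<not> (\<forall>\<^sub>F n in sequentially. dist (z n \<bullet> v) (s \<bullet> v) < e)"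
      by (auto simp: tendsto_iff)
    then have "infinite {n. e \<le> dist (z n \<bullet> v) (s \<bullet> v)}"
      by (simp add: not_eventually frequently_cofinite not_less flip: cofinite_eq_sequentially)
    then obtain q :: "nat \<Rightarrow> nat" where q: "strict_mono q"
      and far: "\<And>n. e \<le> dist (z (q n) \<bullet> v) (s \<bullet> v)"
      by (metis (mono_tags, lifting) infinite_enumerate mem_Collect_eq)
    have "bounded (range (z \<circ> q))" using bdd by (rule bounded_subset) auto
    then obtain p t where p: "strict_mono p" and t: "converges_weakly (z \<circ> q \<circ> p) t"
      by (rule bounded_weakly_convergent_subseq)
    have "t = s"
      using unique[OF strict_mono_o[OF q p] _ r s] t by (simp add: o_assoc)
    then have "(\<lambda>n. z (q (p n)) \<bullet> v) \<longlonglongrightarrow> s \<bullet> v"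
      using t by (simp add: converges_weakly_def)
    then obtain n where "dist (z (q (p n)) \<bullet> v) (s \<bullet> v) < e"
      using \<open>0 < e\<close> metric_LIMSEQ_D by blast
    then show False using far[of "p n"] by simp
  qed
  then have "converges_weakly z s" by (simp add: converges_weakly_def)
  with cluster[OF r s] show ?thesis by blast
qed

section \<open>Minty's theorem and resolvents\<close>

text \<open>
  Minty's theorem at the origin, for a maximal monotone graph. The set \<open>E\<close> is the epigraph of the
  Fitzpatrick function \<open>F (x, u) = (SUP (a, b)\<in>G. x \<bullet> b + a \<bullet> u - a \<bullet> b)\<close>, which equals \<open>a \<bullet> b\<close> at
  the points of \<open>G\<close> and by maximality is at least \<open>x \<bullet> u\<close> everywhere. If \<open>(x, u)\<close> minimises
  \<open>F + \<parallel>\<cdot>\<parallel>\<^sup>2/2\<close>, then the optimality condition tested on \<open>G\<close> shows that \<open>(-u, -x)\<close> is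
  monotonically related to \<open>G\<close> with the margin \<open>\<parallel>x + u\<parallel>\<^sup>2\<close>. So \<open>(-u, -x)\<close> lies in \<open>G\<close>, the margin
  vanishes, and \<open>u = -x\<close>.
\<close>

lemma minty_graph:
  fixes G :: "('h::{real_inner, complete_space} \<times> 'h) set"
  assumes mono: "\<And>a b a' b'. (a, b) \<in> G \<Longrightarrow> (a', b') \<in> G \<Longrightarrow> 0 \<le> (a - a') \<bullet> (b - b')"
    and max: "\<And>x u. (\<And>a b. (a, b) \<in> G \<Longrightarrow> 0 \<le> (x - a) \<bullet> (u - b)) \<Longrightarrow> (x, u) \<in> G"
  shows "\<exists>x. (x, - x) \<in> G"
proof -
  \<comment> \<open>an element of \<open>E\<close> is \<open>e = ((x, u), m)\<close>\<close>
  let ?F = "\<lambda>a b e. fst (fst e) \<bullet> b + a \<bullet> snd (fst e) - a \<bullet> b"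
  define E where "E = (\<Inter>(a, b)\<in>G. {e :: ('h \<times> 'h) \<times> real. ?F a b e \<le> snd e})"
  obtain a0 b0 where ab0: "(a0, b0) \<in> G"
    using max[of 0 0] by fastforce
  have half: "closed {e. ?F a b e \<le> snd e}" "convex {e. ?F a b e \<le> snd e}" for a b :: 'h
  proof -
    show "closed {e. ?F a b e \<le> snd e}"
      by (intro closed_Collect_le continuous_intros)
    show "convex {e. ?F a b e \<le> snd e}"
    proof (rule convexI)
      fix e f :: "('h \<times> 'h) \<times> real" and s t :: real
      assume *: "e \<in> {e. ?F a b e \<le> snd e}" "f \<in> {e. ?F a b e \<le> snd e}" "0 \<le> s" "0 \<le> t" "s + t = 1"
      have "?F a b (s *\<^sub>R e + t *\<^sub>R f) = s * ?F a b e + t * ?F a b f - (1 - (s + t)) * (a \<bullet> b)"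
        by (simp add: algebra_simps)
      also have "\<dots> \<le> s * snd e + t * snd f"
        using * by (simp add: add_mono mult_left_mono)
      finally show "s *\<^sub>R e + t *\<^sub>R f \<in> {e. ?F a b e \<le> snd e}" by simp
    qed
  qed
  have graphE: "((a, b), a \<bullet> b) \<in> E" if "(a, b) \<in> G" for a b
    using mono[OF that] by (fastforce simp: E_def inner_diff_left inner_diff_right)
  have cl: "closed E" unfolding E_def by (intro closed_INT) (use half in auto)
  have cv: "convex E" unfolding E_def by (intro convex_INT) (use half in auto)
  have ne: "E \<noteq> {}" using graphE[OF ab0] by blast
  have lb: "- (a0 \<bullet> b0) - (norm (b0, a0))\<^sup>2 / 2 \<le> m + (norm e)\<^sup>2 / 2" if "(e, m) \<in> E" for e m
  proof -
    have "?F a0 b0 (e, m) \<le> m" using that ab0 by (auto simp: E_def)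
    moreover have "0 \<le> (norm (e + (b0, a0)))\<^sup>2" by simp
    ultimately show ?thesis
      unfolding power2_norm_eq_inner
      by (cases e) (simp add: inner_add_left inner_add_right inner_commute field_simps)
  qed
  obtain e m where e: "(e, m) \<in> E"
    and opt: "\<And>p q. (p, q) \<in> E \<Longrightarrow> m + (norm e)\<^sup>2 \<le> q + e \<bullet> p"
    using quadratic_minimum_over_epigraph[OF cl cv ne lb] by blast
  obtain x u where xu: "e = (x, u)" by (cases e)
  have key: "m + x \<bullet> x + u \<bullet> u \<le> a \<bullet> b + x \<bullet> a + u \<bullet> b" if "(a, b) \<in> G" for a b
    using opt[OF graphE[OF that]] by (simp add: xu power2_norm_eq_inner)
  have F: "x \<bullet> b + a \<bullet> u - a \<bullet> b \<le> m" if "(a, b) \<in> G" for a b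
    using e that by (auto simp: xu E_def)
  have "x \<bullet> u \<le> m"
  proof (rule ccontr)
    assume less: "\<not> x \<bullet> u \<le> m"
    have "(x, u) \<in> G"
    proof (rule max)
      fix a b assume "(a, b) \<in> G"
      from F[OF this] less show "0 \<le> (x - a) \<bullet> (u - b)"
        by (simp add: inner_diff_left inner_diff_right)
    qed
    from F[OF this] less show False by simp
  qed
  then have gap: "(x + u) \<bullet> (x + u) \<le> (- u - a) \<bullet> (- x - b)" if "(a, b) \<in> G" for a b
    using key[OF that] by (simp add: inner_add_left inner_add_right inner_diff_left inner_diff_right inner_commute)
  have inG: "(- u, - x) \<in> G"
    using gap inner_ge_zero[of "x + u"] by (intro max) (meson order_trans)
  from gap[OF inG] have "(x + u) \<bullet> (x + u) \<le> 0" by simp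
  then have "x + u = 0" by (meson inner_gt_zero_iff not_less)
  then have "u = - x" by (simp add: eq_neg_iff_add_eq_0 add.commute)
  with inG show ?thesis by auto
qed

lemma rho_monotoneD:
  assumes "rho_monotone \<rho> A" "u \<in> A x" "v \<in> A y"
  shows "\<rho> * (norm (x - y))\<^sup>2 \<le> (x - y) \<bullet> (u - v)"
  using assms by (auto simp: rho_monotone_def graph_of_def)

text \<open>
  Otherwise adjoining the point \<open>(x, u)\<close> would enlarge the graph.
\<close>

lemma maximally_rho_monotone_memI:
  assumes A: "maximally_rho_monotone \<rho> A"
    and xu: "\<And>y v. v \<in> A y \<Longrightarrow> \<rho> * (norm (x - y))\<^sup>2 \<le> (x - y) \<bullet> (u - v)"
  shows "u \<in> A x"
proof -
  have mono: "rho_monotone \<rho> A"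
    using A by (simp add: maximally_rho_monotone_def)
  let ?A' = "A(x := insert u (A x))"
  have xu': "\<rho> * (norm (y - x))\<^sup>2 \<le> (y - x) \<bullet> (v - u)" if "v \<in> A y" for y v
    using xu[OF that] inner_minus_left[of "x - y" "v - u"] inner_minus_right[of "x - y" "u - v"]
    by (simp add: norm_minus_commute)
  have "rho_monotone \<rho> ?A'"
    unfolding rho_monotone_def
    using xu xu' rho_monotoneD[OF mono]
    by (auto simp: graph_of_def split: if_splits)
  moreover have "graph_of A \<subseteq> graph_of ?A'" by (auto simp: graph_of_def)
  ultimately have "graph_of ?A' = graph_of A"
    using A by (simp add: maximally_rho_monotone_def)
  then show ?thesis by (auto simp: graph_of_def set_eq_iff split: if_splits)
qed

text \<open>
  Subtracting \<open>\<rho> Id\<close> turns \<open>A\<close> into a maximal monotone operator, and an affine change of variable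
  on the range moves the equation \<open>w \<in> x + \<gamma> A x\<close> to the origin; dividing it by \<open>1 + \<gamma>\<rho>\<close> is what
  requires this number to be positive.
\<close>

lemma minty:
  fixes A :: "'h::{real_inner, complete_space} \<Rightarrow> 'h set"
  assumes A: "maximally_rho_monotone \<rho> A" and "0 < \<gamma>" "0 < 1 + \<gamma> * \<rho>"
  obtains x where "(1 / \<gamma>) *\<^sub>R (w - x) \<in> A x"
proof -
  define t where "t = \<gamma> / (1 + \<gamma> * \<rho>)"
  define v where "v = (1 / (1 + \<gamma> * \<rho>)) *\<^sub>R w"
  have t: "0 < t" using assms by (simp add: t_def)
  define G where "G = {(a, t *\<^sub>R (b - \<rho> *\<^sub>R a) - v) | a b. b \<in> A a}"
  have shift: "(a - a') \<bullet> ((t *\<^sub>R (b - \<rho> *\<^sub>R a) - v) - (t *\<^sub>R (b' - \<rho> *\<^sub>R a') - v))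
      = t * ((a - a') \<bullet> (b - b') - \<rho> * (norm (a - a'))\<^sup>2)" for a a' b b'
    unfolding power2_norm_eq_inner by (simp add: algebra_simps inner_commute)
  have "\<exists>x. (x, - x) \<in> G"
  proof (rule minty_graph)
    fix a b a' b' assume "(a, b) \<in> G" "(a', b') \<in> G"
    then obtain d d' where d: "d \<in> A a" "d' \<in> A a'"
      and b: "b = t *\<^sub>R (d - \<rho> *\<^sub>R a) - v" "b' = t *\<^sub>R (d' - \<rho> *\<^sub>R a') - v"
      by (auto simp: G_def)
    have "\<rho> * (norm (a - a'))\<^sup>2 \<le> (a - a') \<bullet> (d - d')"
      using A d by (auto simp: maximally_rho_monotone_def intro: rho_monotoneD)
    then show "0 \<le> (a - a') \<bullet> (b - b')"
      unfolding b shift using t by simp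
  next
    fix x u assume *: "\<And>a b. (a, b) \<in> G \<Longrightarrow> 0 \<le> (x - a) \<bullet> (u - b)"
    define b where "b = (1 / t) *\<^sub>R (u + v) + \<rho> *\<^sub>R x"
    have u: "u = t *\<^sub>R (b - \<rho> *\<^sub>R x) - v" using t by (simp add: b_def)
    have "b \<in> A x"
    proof (rule maximally_rho_monotone_memI[OF A])
      fix y d assume "d \<in> A y"
      then have "0 \<le> (x - y) \<bullet> (u - (t *\<^sub>R (d - \<rho> *\<^sub>R y) - v))"
        by (intro *) (auto simp: G_def)
      then have "0 \<le> t * ((x - y) \<bullet> (b - d) - \<rho> * (norm (x - y))\<^sup>2)"
        unfolding u shift .
      then show "\<rho> * (norm (x - y))\<^sup>2 \<le> (x - y) \<bullet> (b - d)"
        using t by (simp add: zero_le_mult_iff)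
    qed
    with u show "(x, u) \<in> G" by (auto simp: G_def)
  qed
  then obtain x b where b: "b \<in> A x" and x: "- x = t *\<^sub>R (b - \<rho> *\<^sub>R x) - v"
    by (auto simp: G_def)
  have "(1 + \<gamma> * \<rho>) *\<^sub>R (- x) = \<gamma> *\<^sub>R (b - \<rho> *\<^sub>R x) - w"
    unfolding x using assms by (simp add: t_def v_def scaleR_diff_right)
  then have "\<gamma> *\<^sub>R b = w - x" by (simp add: algebra_simps)
  then have "b = (1 / \<gamma>) *\<^sub>R (w - x)"
    using assms(2) by (metis divideR_right inverse_eq_divide less_irrefl)
  with b that show ?thesis by simp
qed

lemma resolvent_scale_iff:
  assumes "\<gamma> \<noteq> 0"
  shows "x \<in> resolvent (scale_op \<gamma> A) w \<longleftrightarrow> (1 / \<gamma>) *\<^sub>R (w - x) \<in> A x"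
proof
  assume "x \<in> resolvent (scale_op \<gamma> A) w"
  then show "(1 / \<gamma>) *\<^sub>R (w - x) \<in> A x"
    using assms by (auto simp: resolvent_def add_op_def scale_op_def)
next
  assume *: "(1 / \<gamma>) *\<^sub>R (w - x) \<in> A x"
  moreover have "w = \<gamma> *\<^sub>R ((1 / \<gamma>) *\<^sub>R (w - x)) + x" using assms by simp
  ultimately show "x \<in> resolvent (scale_op \<gamma> A) w"
    unfolding resolvent_def add_op_def scale_op_def by blast
qed

text \<open>
  The resolvent is Lipschitzian with constant \<open>1/(1 + \<gamma>\<rho>)\<close>; in particular it has at most one value
  if \<open>1 + \<gamma>\<rho> > 0\<close>.
\<close>

lemma resolvent_stability:
  fixes A :: "'h::real_inner \<Rightarrow> 'h set"
  assumes A: "rho_monotone \<rho> A" and g: "0 < \<gamma>"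
    and x: "(1 / \<gamma>) *\<^sub>R (w - x) \<in> A x" and x': "(1 / \<gamma>) *\<^sub>R (w' - x') \<in> A x'"
  shows "(1 + \<gamma> * \<rho>) * norm (x - x') \<le> norm (w - w')"
proof (cases "x = x'")
  case False
  have "\<rho> * (norm (x - x'))\<^sup>2 \<le> (1 / \<gamma>) * ((x - x') \<bullet> (w - w') - (norm (x - x'))\<^sup>2)"
    using rho_monotoneD[OF A x x']
    by (simp add: power2_norm_eq_inner algebra_simps)
  then have "(1 + \<gamma> * \<rho>) * (norm (x - x'))\<^sup>2 \<le> (x - x') \<bullet> (w - w')"
    using g by (simp add: field_simps)
  also have "\<dots> \<le> norm (x - x') * norm (w - w')" by (rule norm_cauchy_schwarz)
  finally have "norm (x - x') * ((1 + \<gamma> * \<rho>) * norm (x - x')) \<le> norm (x - x') * norm (w - w')"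
    by (simp add: power2_eq_square algebra_simps)
  then show ?thesis using False by (simp add: mult_le_cancel_left)
qed simp

lemma the_elem_resolvent:
  fixes A :: "'h::{real_inner, complete_space} \<Rightarrow> 'h set"
  assumes A: "maximally_rho_monotone \<rho> A" and g: "0 < \<gamma>" "0 < 1 + \<gamma> * \<rho>"
    and x: "x = the_elem (resolvent (scale_op \<gamma> A) w)"
  shows "(1 / \<gamma>) *\<^sub>R (w - x) \<in> A x"
proof -
  obtain p where p: "(1 / \<gamma>) *\<^sub>R (w - p) \<in> A p" using minty[OF A g] .
  have "q = p" if q: "(1 / \<gamma>) *\<^sub>R (w - q) \<in> A q" for q
  proof -
    have "(1 + \<gamma> * \<rho>) * norm (q - p) \<le> norm (w - w)"
      using resolvent_stability[OF _ g(1) q p] A by (simp add: maximally_rho_monotone_def)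
    then have "norm (q - p) \<le> 0" using g by (simp add: mult_le_0_iff)
    then show ?thesis by simp
  qed
  then have "q \<in> resolvent (scale_op \<gamma> A) w \<longleftrightarrow> q = p" for q
    using p g(1) resolvent_scale_iff[of \<gamma> q A w] by blast
  then have "resolvent (scale_op \<gamma> A) w = {p}" by blast
  with p x show ?thesis by simp
qed

section \<open>Demiclosedness of perturbed maximally monotone operators\<close>

text \<open>
  Testing the inequality at \<open>p = J (s - t F s)\<close>, the resolvent being that of \<open>t A\<close>, gives
  \<open>\<parallel>s - p\<parallel>\<^sup>2 \<le> t (s - p) \<bullet> (F s - F p)\<close>. For \<open>t < 1/l\<close> this forces \<open>s = p\<close>.
\<close>

lemma zero_of_variational_inequality:
  fixes A :: "'h::{real_inner, complete_space} \<Rightarrow> 'h set"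
  assumes A: "maximally_rho_monotone \<rho> A" and F: "l-lipschitz_on UNIV F"
    and vi: "\<And>p q. q \<in> A p \<Longrightarrow> (s - p) \<bullet> (q + F p) \<le> 0"
  shows "- F s \<in> A s"
proof -
  have l: "0 \<le> l" using F by (rule lipschitz_on_nonneg)
  \<comment> \<open>small enough for \<open>t l < 1\<close> and for the resolvent of \<open>t A\<close> to exist\<close>
  define t where "t = 1 / (1 + l + \<bar>\<rho>\<bar>)"
  have t: "0 < t" using l by (simp add: t_def)
  have "t * (1 + l + \<bar>\<rho>\<bar>) = 1" using l by (simp add: t_def)
  then have "t + t * l + t * \<bar>\<rho>\<bar> = 1" by (simp only: distrib_left mult_1_right)
  moreover have "0 \<le> t * l" "0 \<le> t * \<bar>\<rho>\<bar>" "- (t * \<rho>) \<le> t * \<bar>\<rho>\<bar>"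
    using t l abs_ge_minus_self[of "t * \<rho>"] by (simp_all add: abs_mult)
  ultimately have "t * l < 1" and t\<rho>: "0 < 1 + t * \<rho>" using t by linarith+
  obtain p where p: "(1 / t) *\<^sub>R (s - t *\<^sub>R F s - p) \<in> A p"
    using minty[OF A t t\<rho>] .
  have "(1 / t) *\<^sub>R (s - t *\<^sub>R F s - p) + F p = (1 / t) *\<^sub>R (s - p) - (F s - F p)"
    using t by (simp add: algebra_simps)
  from vi[OF p, unfolded this] have "(1 / t) * (norm (s - p))\<^sup>2 \<le> (s - p) \<bullet> (F s - F p)"
    by (simp add: inner_diff_right power2_norm_eq_inner)
  also have "\<dots> \<le> norm (s - p) * norm (F s - F p)" by (rule norm_cauchy_schwarz)
  also have "\<dots> \<le> norm (s - p) * (l * norm (s - p))"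
    using lipschitz_onD[OF F, of s p] by (intro mult_left_mono) (auto simp: dist_norm)
  finally have "(1 - t * l) * (norm (s - p))\<^sup>2 \<le> 0"
    using t by (simp add: field_simps power2_eq_square)
  then have "(norm (s - p))\<^sup>2 \<le> 0" using \<open>t * l < 1\<close> by (simp add: mult_le_0_iff)
  then have "s = p" by simp
  with p t show ?thesis by simp
qed

lemma weak_strong_inner:
  fixes x v :: "nat \<Rightarrow> 'h::real_inner"
  assumes x: "converges_weakly x s" and b: "\<And>n. norm (x n) \<le> M" and v: "v \<longlonglongrightarrow> 0"
  shows "(\<lambda>n. x n \<bullet> v n) \<longlonglongrightarrow> 0"
proof (rule Lim_null_comparison)
  have "norm (x n \<bullet> v n) \<le> M * norm (v n)" for n
    using order_trans[OF Cauchy_Schwarz_ineq2 mult_right_mono[OF b norm_ge_zero]] by simp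
  then show "\<forall>\<^sub>F n in sequentially. norm (x n \<bullet> v n) \<le> M * norm (v n)" by simp
  show "(\<lambda>n. M * norm (v n)) \<longlonglongrightarrow> 0"
    using tendsto_mult_left[OF tendsto_norm_zero[OF v], of M] by simp
qed

text \<open>
  The graph of the monotone operator \<open>A + F\<close> is closed for weak convergence of points and strong
  convergence of values: the monotonicity inequality against any given point of the graph passes
  to the limit.
\<close>

lemma weak_limit_of_approximate_zeros:
  fixes A :: "'h::{real_inner, complete_space} \<Rightarrow> 'h set"
  assumes A: "maximally_rho_monotone \<rho> A" and F: "l-lipschitz_on UNIV F"
    and mono: "\<And>x u y v. u \<in> A x \<Longrightarrow> v \<in> A y \<Longrightarrow> 0 \<le> (x - y) \<bullet> ((u + F x) - (v + F y))"
    and a: "\<And>n. a n \<in> A (x n)" and res: "(\<lambda>n. a n + F (x n)) \<longlonglongrightarrow> 0"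
    and x: "converges_weakly x s" "\<And>n. norm (x n) \<le> M"
  shows "- F s \<in> A s"
proof (rule zero_of_variational_inequality[OF A F])
  fix p q assume q: "q \<in> A p"
  have weak: "(\<lambda>n. x n \<bullet> v) \<longlonglongrightarrow> s \<bullet> v" for v
    using x(1) by (simp add: converges_weakly_def)
  have "(\<lambda>n. x n \<bullet> (a n + F (x n)) - p \<bullet> (a n + F (x n)) - (x n \<bullet> (q + F p) - p \<bullet> (q + F p)))
      \<longlonglongrightarrow> 0 - p \<bullet> 0 - (s \<bullet> (q + F p) - p \<bullet> (q + F p))"
    by (intro tendsto_diff weak_strong_inner[OF x res] weak tendsto_inner tendsto_const res)
  moreover have "0 \<le> x n \<bullet> (a n + F (x n)) - p \<bullet> (a n + F (x n)) - (x n \<bullet> (q + F p) - p \<bullet> (q + F p))" for n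
    using mono[OF a q] by (simp only: inner_diff_left inner_diff_right)
  ultimately have "0 \<le> 0 - p \<bullet> 0 - (s \<bullet> (q + F p) - p \<bullet> (q + F p))"
    by (intro LIMSEQ_le_const) auto
  then show "(s - p) \<bullet> (q + F p) \<le> 0" by (simp add: inner_diff_left)
qed

section \<open>One exact forward-backward-half-forward step\<close>

lemma cocoercive_lipschitz:
  assumes "cocoercive \<beta> C" "0 < \<beta>"
  shows "(1 / \<beta>)-lipschitz_on UNIV C"
proof (rule lipschitz_onI)
  fix x y
  have "\<beta> * (norm (C x - C y))\<^sup>2 \<le> (x - y) \<bullet> (C x - C y)"
    using assms by (simp add: cocoercive_def)
  also have "\<dots> \<le> norm (x - y) * norm (C x - C y)" by (rule norm_cauchy_schwarz)
  finally have *: "(\<beta> * norm (C x - C y)) * norm (C x - C y) \<le> norm (x - y) * norm (C x - C y)"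
    by (simp add: power2_eq_square)
  have "\<beta> * norm (C x - C y) \<le> norm (x - y)"
  proof (cases "C x = C y")
    case False
    then show ?thesis using mult_right_le_imp_le[OF *] by simp
  qed simp
  then show "dist (C x) (C y) \<le> 1 / \<beta> * dist x y"
    using assms(2) by (simp add: dist_norm field_simps)
qed (use assms in auto)

lemma cocoercive_monotone:
  assumes "cocoercive \<beta> C" "0 < \<beta>"
  shows "0 \<le> (x - y) \<bullet> (C x - C y)"
proof -
  have "0 \<le> \<beta> * (norm (C x - C y))\<^sup>2" using assms(2) by simp
  also have "\<dots> \<le> (x - y) \<bullet> (C x - C y)" using assms(1) by (simp add: cocoercive_def)
  finally show ?thesis .
qed

text \<open>
  The forward term is evaluated at \<open>z\<close> but tested at the later point \<open>x\<close>. The mismatch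
  \<open>(x - z) \<bullet> (C z - C s)\<close> is absorbed by the cocoercivity through Young's inequality, which costs
  \<open>\<parallel>x - z\<parallel>\<^sup>2/(4\<beta>)\<close>.
\<close>

lemma cocoercive_lagged_inner:
  assumes "cocoercive \<beta> C" "0 < \<beta>"
  shows "- (norm (x - z))\<^sup>2 / (4 * \<beta>) \<le> (x - s) \<bullet> (C z - C s)"
proof -
  have "\<beta> * (norm (C z - C s))\<^sup>2 \<le> (z - s) \<bullet> (C z - C s)"
    using assms by (simp add: cocoercive_def)
  moreover have "- (norm (x - z) * norm (C z - C s)) \<le> (x - z) \<bullet> (C z - C s)"
    using Cauchy_Schwarz_ineq2[of "x - z" "C z - C s"] by simp
  moreover have "(x - s) \<bullet> (C z - C s) = (z - s) \<bullet> (C z - C s) + (x - z) \<bullet> (C z - C s)"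
    by (simp add: inner_diff_left)
  moreover have "- (norm (x - z))\<^sup>2 / (4 * \<beta>)
      \<le> \<beta> * (norm (C z - C s))\<^sup>2 - norm (x - z) * norm (C z - C s)"
  proof -
    have "0 \<le> (norm (x - z) - 2 * \<beta> * norm (C z - C s))\<^sup>2 / (4 * \<beta>)"
      using assms(2) by simp
    also have "\<dots> = (norm (x - z))\<^sup>2 / (4 * \<beta>) + \<beta> * (norm (C z - C s))\<^sup>2 - norm (x - z) * norm (C z - C s)"
      using assms(2) by (simp add: field_simps power2_eq_square)
    finally show ?thesis by simp
  qed
  ultimately show ?thesis by linarith
qed

text \<open>
  Monotonicity of \<open>A + D\<close> between \<open>x\<close> and \<open>s\<close> bounds \<open>(x - s) \<bullet> (z - w)\<close> from below, because the
  correction \<open>\<gamma>(D z - D x)\<close> is chosen so that \<open>z - w\<close> is \<open>\<gamma>\<close> times an element of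
  \<open>A x + D x + C z\<close>. The identity
  \<open>2 (x - s) \<bullet> (z - w) = \<parallel>x - w\<parallel>\<^sup>2 - \<parallel>x - z\<parallel>\<^sup>2 + \<parallel>z - s\<parallel>\<^sup>2 - \<parallel>w - s\<parallel>\<^sup>2\<close> turns this into a
  statement on distances, and \<open>\<parallel>x - w\<parallel>\<close> is controlled by the Lipschitz constant of \<open>D\<close>.
\<close>

lemma forward_backward_half_forward_step:
  fixes A :: "'h::real_inner \<Rightarrow> 'h set"
  assumes mono: "\<And>x u y v. u \<in> A x \<Longrightarrow> v \<in> A y
      \<Longrightarrow> \<sigma> * (norm (x - y))\<^sup>2 \<le> (x - y) \<bullet> ((u + D x) - (v + D y))"
    and C: "cocoercive \<beta> C" "0 < \<beta>" and D: "k-lipschitz_on UNIV D" and g: "0 < \<gamma>"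
    and s: "- (C s + D s) \<in> A s"
    and x: "(1 / \<gamma>) *\<^sub>R (z - \<gamma> *\<^sub>R (C z + D z) - x) \<in> A x"
  defines "w \<equiv> x + \<gamma> *\<^sub>R (D z - D x)"
  shows "(norm (w - s))\<^sup>2 \<le> (norm (z - s))\<^sup>2
    - (1 - \<gamma>\<^sup>2 * k\<^sup>2 - \<gamma> / (2 * \<beta>)) * (norm (x - z))\<^sup>2 - 2 * \<gamma> * \<sigma> * (norm (x - s))\<^sup>2"
proof -
  have "((1 / \<gamma>) *\<^sub>R (z - \<gamma> *\<^sub>R (C z + D z) - x) + D x) - (- (C s + D s) + D s)
      = (1 / \<gamma>) *\<^sub>R (z - w) - (C z - C s)"
    using g by (simp add: w_def algebra_simps)
  from mono[OF x s, unfolded this]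
  have "\<gamma> * (\<sigma> * (norm (x - s))\<^sup>2) \<le> \<gamma> * ((1 / \<gamma>) * ((x - s) \<bullet> (z - w)) - (x - s) \<bullet> (C z - C s))"
    using g by (intro mult_left_mono) (auto simp: inner_diff_right)
  also have "\<dots> = (x - s) \<bullet> (z - w) - \<gamma> * ((x - s) \<bullet> (C z - C s))"
    using g by (simp add: right_diff_distrib)
  also have "\<dots> \<le> (x - s) \<bullet> (z - w) + \<gamma> * ((norm (x - z))\<^sup>2 / (4 * \<beta>))"
    using mult_left_mono[OF cocoercive_lagged_inner[OF C, of x z s], of \<gamma>] g by simp
  finally have 1: "2 * \<gamma> * \<sigma> * (norm (x - s))\<^sup>2 \<le> 2 * ((x - s) \<bullet> (z - w)) + \<gamma> / (2 * \<beta>) * (norm (x - z))\<^sup>2"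
    by simp
  have 2: "2 * ((x - s) \<bullet> (z - w)) = (norm (x - w))\<^sup>2 - (norm (x - z))\<^sup>2 + (norm (z - s))\<^sup>2 - (norm (w - s))\<^sup>2"
    unfolding power2_norm_eq_inner by (simp add: algebra_simps inner_commute)
  have "norm (x - w) = \<gamma> * norm (D z - D x)"
    using g by (simp add: w_def)
  also have "\<dots> \<le> \<gamma> * (k * norm (x - z))"
    using lipschitz_onD[OF D, of z x] g by (intro mult_left_mono) (auto simp: dist_norm norm_minus_commute)
  finally have "(norm (x - w))\<^sup>2 \<le> (\<gamma> * (k * norm (x - z)))\<^sup>2"
    by (intro power_mono) auto
  also have "\<dots> = \<gamma>\<^sup>2 * k\<^sup>2 * (norm (x - z))\<^sup>2" by (simp add: power_mult_distrib)
  finally have 3: "(norm (x - w))\<^sup>2 \<le> \<gamma>\<^sup>2 * k\<^sup>2 * (norm (x - z))\<^sup>2" .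
  show ?thesis using 1 2 3 by (simp add: left_diff_distrib)
qed

text \<open>
  The first bound in the definition of \<open>chi\<close> is the positive root of \<open>\<gamma>\<^sup>2k\<^sup>2 + \<gamma>/(2\<beta>) = 1\<close>.
  Staying \<open>\<epsilon>\<close> below it leaves a margin, of which the linear term alone provides \<open>\<epsilon>/(2\<beta>)\<close>.
\<close>

lemma chi_margin:
  assumes "0 < \<beta>" "0 < \<epsilon>" "0 < \<gamma>" "\<gamma> \<le> chi \<rho> \<beta> k - \<epsilon>"
  shows "\<epsilon> / (2 * \<beta>) \<le> 1 - \<gamma>\<^sup>2 * k\<^sup>2 - \<gamma> / (2 * \<beta>)"
proof -
  define r where "r = sqrt (1 + 16 * \<beta>\<^sup>2 * k\<^sup>2)"
  define \<chi>\<^sub>0 where "\<chi>\<^sub>0 = 4 * \<beta> / (1 + r)"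
  have r: "0 \<le> r" "r\<^sup>2 = 1 + 16 * \<beta>\<^sup>2 * k\<^sup>2" by (auto simp: r_def)
  have g: "\<gamma> \<le> \<chi>\<^sub>0 - \<epsilon>"
    using assms(4) by (simp add: chi_def Let_def \<chi>\<^sub>0_def r_def split: if_splits)
  have "\<chi>\<^sub>0\<^sup>2 * k\<^sup>2 * (1 + r)\<^sup>2 = 16 * \<beta>\<^sup>2 * k\<^sup>2"
    using r(1) by (simp add: \<chi>\<^sub>0_def power_divide power_mult_distrib)
  also have "\<dots> = (r - 1) * (1 + r)" using r(2) by (simp add: algebra_simps power2_eq_square)
  finally have "\<chi>\<^sub>0\<^sup>2 * k\<^sup>2 * (1 + r) = r - 1"
    using r(1) by (simp add: power2_eq_square flip: mult.assoc)
  moreover have "\<chi>\<^sub>0 / (2 * \<beta>) * (1 + r) = 2"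
    using r(1) assms(1) add_pos_nonneg[of 1 r] unfolding \<chi>\<^sub>0_def
    by (subst times_divide_eq_left, subst divide_eq_eq) (auto simp: field_simps)
  ultimately have "(\<chi>\<^sub>0\<^sup>2 * k\<^sup>2 + \<chi>\<^sub>0 / (2 * \<beta>)) * (1 + r) = 1 * (1 + r)"
    by (simp only: distrib_right) simp
  then have root: "\<chi>\<^sub>0\<^sup>2 * k\<^sup>2 + \<chi>\<^sub>0 / (2 * \<beta>) = 1"
    using r(1) by (subst (asm) mult_cancel_right) auto
  have "\<gamma>\<^sup>2 * k\<^sup>2 \<le> \<chi>\<^sub>0\<^sup>2 * k\<^sup>2"
    using g assms by (intro mult_right_mono power_mono) auto
  moreover have "\<gamma> / (2 * \<beta>) \<le> (\<chi>\<^sub>0 - \<epsilon>) / (2 * \<beta>)"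
    using g assms by (intro divide_right_mono) auto
  ultimately show ?thesis using root by (simp add: diff_divide_distrib)
qed

text \<open>
  For \<open>\<rho> < 0\<close>, the second bound \<open>-1/\<rho>\<close> keeps \<open>1 + \<gamma>\<rho>\<close> away from zero, uniformly in \<open>\<gamma>\<close>.
\<close>

lemma chi_resolvent_margin:
  assumes "0 < \<epsilon>" "0 < \<gamma>" "\<gamma> \<le> chi \<rho> \<beta> k - \<epsilon>"
  shows "(if \<rho> \<ge> 0 then 1 else - \<epsilon> * \<rho>) \<le> 1 + \<gamma> * \<rho>"
proof (cases "\<rho> \<ge> 0")
  case False
  then have "\<gamma> + \<epsilon> \<le> - 1 / \<rho>" using assms(3) by (simp add: chi_def Let_def)
  then have "(\<gamma> + \<epsilon>) * \<rho> \<ge> (- 1 / \<rho>) * \<rho>" using False by (intro mult_right_mono_neg) auto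
  then show ?thesis using False by (simp add: algebra_simps)
qed (use assms in simp)

section \<open>Sequences with summable or geometric errors\<close>

text \<open>
  The quantity \<open>1 + a n\<close> grows at most by the factor \<open>1 + e n \<le> exp (e n)\<close>.
\<close>

lemma perturbed_growth_bounded:
  fixes a e :: "nat \<Rightarrow> real"
  assumes "summable e" "\<And>n. 0 \<le> e n" "\<And>n. 0 \<le> a n"
    and step: "\<And>n. a (Suc n) \<le> a n + e n * (1 + a n)"
  obtains M where "\<And>n. a n \<le> M"
proof -
  have "1 + a n \<le> (1 + a 0) * exp (\<Sum>k<n. e k)" for n
  proof (induction n)
    case (Suc n)
    have "1 + a (Suc n) \<le> (1 + a n) * (1 + e n)" using step[of n] by (simp add: algebra_simps)
    also have "\<dots> \<le> (1 + a n) * exp (e n)" using assms(3)[of n] by (intro mult_left_mono exp_ge_add_one_self) auto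
    also have "\<dots> \<le> ((1 + a 0) * exp (\<Sum>k<n. e k)) * exp (e n)"
      by (intro mult_right_mono Suc.IH) auto
    finally show ?case by (simp add: exp_add mult.assoc)
  qed simp
  moreover have "(1 + a 0) * exp (\<Sum>k<n. e k) \<le> (1 + a 0) * exp (suminf e)" for n
    using assms(3)[of 0] sum_le_suminf[OF assms(1), of "{..<n}"] assms(2)
    by (intro mult_left_mono) auto
  ultimately have "1 + a n \<le> (1 + a 0) * exp (suminf e)" for n
    by (rule order_trans)
  then have "a n \<le> (1 + a 0) * exp (suminf e) - 1" for n
    by (simp add: le_diff_eq add.commute)
  then show ?thesis by (rule that)
qed

text \<open>
  Subtracting the partial sums of \<open>e\<close> makes \<open>d\<close> decreasing.
\<close>

lemma quasi_decreasing_convergent: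
  fixes d t e :: "nat \<Rightarrow> real"
  assumes "summable e" "\<And>n. 0 \<le> d n" "\<And>n. 0 \<le> t n"
    and step: "\<And>n. d (Suc n) \<le> d n - t n + e n"
  shows "convergent d" "t \<longlonglongrightarrow> 0"
proof -
  define b where "b = (\<lambda>n. d n - (\<Sum>k<n. e k))"
  have sume: "(\<lambda>n. \<Sum>k<n. e k) \<longlonglongrightarrow> suminf e" using assms(1) by (rule summable_LIMSEQ)
  then obtain M where M: "\<And>n. (\<Sum>k<n. e k) \<le> M"
    using convergent_imp_Bseq[OF convergentI[OF sume]] unfolding Bseq_def real_norm_def
    by (meson abs_le_D1)
  have dec: "decseq b"
  proof (rule decseq_SucI)
    show "b (Suc n) \<le> b n" for n using step[of n] assms(3)[of n] by (simp add: b_def)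
  qed
  moreover have "- M \<le> b n" for n using assms(2)[of n] M[of n] by (simp add: b_def)
  ultimately obtain l where l: "b \<longlonglongrightarrow> l" using decseq_convergent[of b "- M"] by metis
  have "(\<lambda>n. b n + (\<Sum>k<n. e k)) \<longlonglongrightarrow> l + suminf e" by (intro tendsto_add l sume)
  then have d: "d \<longlonglongrightarrow> l + suminf e" by (simp add: b_def)
  then show "convergent d" by (rule convergentI)
  have "(\<lambda>n. b n - b (Suc n)) \<longlonglongrightarrow> l - l" by (intro tendsto_diff l LIMSEQ_Suc)
  then have lim: "(\<lambda>n. b n - b (Suc n)) \<longlonglongrightarrow> 0" by simp
  have "t n \<le> b n - b (Suc n)" for n using step[of n] by (simp add: b_def)
  then show "t \<longlonglongrightarrow> 0"
    by (intro tendsto_sandwich[OF _ _ tendsto_const lim] always_eventually allI assms(3))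
qed

text \<open>
  Any rate \<open>r\<close> above \<open>q\<close> and \<open>\<eta>\<close> works, with a constant \<open>R\<close> such that \<open>q R + E \<le> R r\<close>. The rate
  must exceed \<open>q\<close> strictly, since \<open>q = \<eta>\<close> would produce a factor \<open>n\<close>.
\<close>

lemma geometric_perturbation_decay:
  fixes a :: "nat \<Rightarrow> real"
  assumes q: "0 \<le> q" "q < 1" and \<eta>: "0 \<le> \<eta>" "\<eta> < 1" and E: "0 \<le> E" and a0: "0 \<le> a 0"
    and step: "\<And>n. a (Suc n) \<le> q * a n + E * \<eta> ^ n"
  shows "\<exists>R r. R \<ge> 0 \<and> 0 < r \<and> r < 1 \<and> (\<forall>n. a n \<le> R * r ^ n)"
proof -
  define r where "r = (1 + max q \<eta>) / 2"
  define R where "R = a 0 + E / (r - q)"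
  have r: "0 < r" "r < 1" "q < r" "\<eta> \<le> r" using q \<eta> by (auto simp: r_def)
  have "0 \<le> E / (r - q)" using r E by simp
  then have R: "0 \<le> R" "a 0 \<le> R" "E / (r - q) \<le> R" using a0 by (auto simp: R_def)
  then have qR: "q * R + E \<le> R * r" using r(3) by (simp add: field_simps)
  have "a n \<le> R * r ^ n" for n
  proof (induction n)
    case (Suc n)
    have "a (Suc n) \<le> q * (R * r ^ n) + E * r ^ n"
      using step[of n] mult_left_mono[OF Suc.IH q(1)] mult_left_mono[OF power_mono[OF r(4) \<eta>(1), of n] E]
      by linarith
    also have "\<dots> = (q * R + E) * r ^ n" by (simp add: algebra_simps)
    also have "\<dots> \<le> (R * r) * r ^ n" using qR r by (intro mult_right_mono) auto
    finally show ?case by simp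
  qed (use R in simp)
  with R(1) r(1,2) show ?thesis by (intro exI[of _ R] exI[of _ r] conjI allI)
qed

text \<open>
  Here \<open>w n\<close> is where an exact step would lead from \<open>z n\<close>. The relative error bounds the distances
  first; once they are bounded, the error is absolute and survives the passage to squares.
\<close>

lemma quasi_fejer:
  fixes z w :: "nat \<Rightarrow> 'h::real_inner"
  assumes e: "summable e" "\<And>n. 0 \<le> e n" and t: "\<And>n. 0 \<le> t n"
    and w: "\<And>n. (norm (w n - s))\<^sup>2 \<le> (norm (z n - s))\<^sup>2 - t n"
    and z: "\<And>n. norm (z (Suc n) - w n) \<le> e n * (1 + norm (z n - s))"
  shows "convergent (\<lambda>n. (norm (z n - s))\<^sup>2)" "t \<longlonglongrightarrow> 0" "\<exists>M. \<forall>n. norm (z n - s) \<le> M"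
proof -
  have ws: "norm (w n - s) \<le> norm (z n - s)" for n
    using w[of n] t[of n] by (auto intro: power2_le_imp_le[OF order_trans])
  have zs: "norm (z (Suc n) - s) \<le> norm (w n - s) + e n * (1 + norm (z n - s))" for n
    using z[of n] norm_triangle_ineq[of "z (Suc n) - w n" "w n - s"] by simp
  obtain M where M: "\<And>n. norm (z n - s) \<le> M"
  proof (rule perturbed_growth_bounded[OF e])
    show "norm (z (Suc n) - s) \<le> norm (z n - s) + e n * (1 + norm (z n - s))" for n
      using zs[of n] ws[of n] by linarith
  qed auto
  then show "\<exists>M. \<forall>n. norm (z n - s) \<le> M" by blast
  have M0: "0 \<le> M" using M[of 0] norm_ge_zero order_trans by blast
  obtain E where E: "\<And>n. e n \<le> E"
    using summable_imp_Bseq[OF e(1)] unfolding Bseq_def real_norm_def by (meson abs_le_D1)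
  define H where "H = 2 * M * (1 + M) + E * (1 + M)\<^sup>2"
  have step: "(norm (z (Suc n) - s))\<^sup>2 \<le> (norm (z n - s))\<^sup>2 - t n + e n * H" for n
  proof -
    let ?a = "norm (w n - s)" and ?d = "e n * (1 + M)"
    have aM: "?a \<le> M" using ws[of n] M[of n] by linarith
    have "e n * (1 + norm (z n - s)) \<le> ?d" using M e(2) by (intro mult_left_mono) auto
    then have "norm (z (Suc n) - s) \<le> ?a + ?d" using zs[of n] by linarith
    then have "(norm (z (Suc n) - s))\<^sup>2 \<le> (?a + ?d)\<^sup>2" by (intro power_mono) auto
    also have "\<dots> = ?a\<^sup>2 + e n * (2 * ?a * (1 + M) + e n * (1 + M)\<^sup>2)"
      by (simp add: power2_eq_square algebra_simps)
    also have "\<dots> \<le> ?a\<^sup>2 + e n * H"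
      unfolding H_def using aM E[of n] e(2)[of n] M0
      by (intro add_left_mono mult_left_mono add_mono mult_right_mono) auto
    finally show ?thesis using w[of n] by linarith
  qed
  have "summable (\<lambda>n. e n * H)" using e(1) by (rule summable_mult2)
  from quasi_decreasing_convergent[OF this _ t step]
  show "convergent (\<lambda>n. (norm (z n - s))\<^sup>2)" "t \<longlonglongrightarrow> 0" by auto
qed

section \<open>The perturbed forward-backward-half-forward method\<close>

text \<open>
  The resolvent being Lipschitzian, the perturbed resolvent point \<open>x\<close> and the exact one \<open>p\<close> differ
  by \<open>O(w (1 + \<parallel>z - s\<parallel>))\<close>. The correction term adds the errors of \<open>D'\<close> at \<open>z\<close> and at \<open>x\<close>, and both
  points are at a distance of \<open>s\<close> that is controlled by \<open>1 + \<parallel>z - s\<parallel>\<close>, because \<open>s\<close> is a fixed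
  point of the exact resolvent step, of which \<open>h\<close> is a Lipschitz constant. In \<open>M\<close>, the first
  summand is the displacement of the resolvent point, also through the Lipschitz correction; the
  others are the errors of \<open>D'\<close> at \<open>z\<close> and at \<open>p\<close>.
\<close>

lemma perturbed_step_error:
  fixes A :: "'h::real_inner \<Rightarrow> 'h set"
  assumes A: "rho_monotone \<rho> A" and F: "f-lipschitz_on UNIV (\<lambda>v. C v + D v)"
    and D: "k-lipschitz_on UNIV D" and g: "0 < \<gamma>" "\<gamma> \<le> g" and \<mu>: "0 < \<mu>" "\<mu> \<le> 1 + \<gamma> * \<rho>"
    and w: "0 \<le> w" "w \<le> W" and PQ: "0 \<le> P" "0 \<le> Q"
    and D': "\<And>v. norm (D' v - D v) \<le> w * (P + Q * norm (v - s))"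
    and s: "- (C s + D s) \<in> A s"
    and x: "(1 / \<gamma>) *\<^sub>R (z - \<gamma> *\<^sub>R (C z + D' z) - x) \<in> A x"
    and p: "(1 / \<gamma>) *\<^sub>R (z - \<gamma> *\<^sub>R (C z + D z) - p) \<in> A p"
  defines "h \<equiv> (1 + g * f) / \<mu>"
  defines "M \<equiv> g / \<mu> * (P + Q) * (1 + g * k + g * Q * W) + g * (P + Q) + g * (P + Q * h)"
  shows "norm ((x + \<gamma> *\<^sub>R (D' z - D' x)) - (p + \<gamma> *\<^sub>R (D z - D p)))
    \<le> w * M * (1 + norm (z - s))"
    and "0 \<le> M"
proof -
  have k: "0 \<le> k" using D by (rule lipschitz_on_nonneg)
  have f: "0 \<le> f" using F by (rule lipschitz_on_nonneg)
  have g0: "0 \<le> g" and W0: "0 \<le> W" using g w by linarith+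
  define G where "G = g / \<mu>"
  have h: "0 \<le> h" using g0 f \<mu>(1) by (simp add: h_def)
  show "0 \<le> M" using g0 k h PQ \<mu>(1) W0 by (simp add: M_def)
  define r where "r = 1 + norm (z - s)"
  have r: "1 \<le> r" "norm (z - s) \<le> r" by (auto simp: r_def)
  have smem: "(1 / \<gamma>) *\<^sub>R ((s - \<gamma> *\<^sub>R (C s + D s)) - s) \<in> A s"
    using s g(1) by simp
  have cancel: "norm (a - b) \<le> c / \<mu>" if "(1 + \<gamma> * \<rho>) * norm (a - b) \<le> c" for a b :: 'h and c
  proof -
    have "\<mu> * norm (a - b) \<le> (1 + \<gamma> * \<rho>) * norm (a - b)"
      using \<mu>(2) by (intro mult_right_mono) auto
    with that show ?thesis using \<mu>(1) by (simp add: field_simps)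
  qed
  have size: "P + Q * norm (z - s) \<le> (P + Q) * r"
    using PQ by (simp add: r_def algebra_simps)
  have gn: "\<gamma> * c \<le> g * c" if "0 \<le> c" for c
    using g(2) that by (intro mult_right_mono) auto
  have err_z: "norm (D' z - D z) \<le> w * ((P + Q) * r)"
    using D'[of z] mult_left_mono[OF size w(1)] by linarith
  have "norm (x - p) \<le> norm ((z - \<gamma> *\<^sub>R (C z + D' z)) - (z - \<gamma> *\<^sub>R (C z + D z))) / \<mu>"
    by (intro cancel resolvent_stability[OF A g(1) x p])
  also have "\<dots> = norm (\<gamma> *\<^sub>R (D' z - D z)) / \<mu>"
    by (simp add: algebra_simps norm_minus_commute)
  also have "\<dots> \<le> (g * (w * ((P + Q) * r))) / \<mu>"
    using g g0 err_z \<mu>(1) by (intro divide_right_mono) (auto intro!: mult_mono)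
  finally have d: "norm (x - p) \<le> w * (G * (P + Q)) * r"
    by (simp add: G_def mult_ac)
  have "norm (p - s) \<le> norm ((z - \<gamma> *\<^sub>R (C z + D z)) - (s - \<gamma> *\<^sub>R (C s + D s))) / \<mu>"
    by (intro cancel resolvent_stability[OF A g(1) p smem])
  also have "\<dots> \<le> (norm (z - s) + g * (f * norm (z - s))) / \<mu>"
  proof (rule divide_right_mono)
    have "norm ((z - \<gamma> *\<^sub>R (C z + D z)) - (s - \<gamma> *\<^sub>R (C s + D s)))
        = norm ((z - s) - \<gamma> *\<^sub>R ((C z + D z) - (C s + D s)))"
      by (simp add: algebra_simps)
    also have "\<dots> \<le> norm (z - s) + norm (\<gamma> *\<^sub>R ((C z + D z) - (C s + D s)))"
      by (rule norm_triangle_ineq4)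
    also have "norm (\<gamma> *\<^sub>R ((C z + D z) - (C s + D s)))
        \<le> g * (f * norm (z - s))"
      using lipschitz_onD[OF F, of z s] g(1) g(2) g
      by (simp add: dist_norm mult_mono)
    finally show "norm ((z - \<gamma> *\<^sub>R (C z + D z)) - (s - \<gamma> *\<^sub>R (C s + D s)))
        \<le> norm (z - s) + g * (f * norm (z - s))" by simp
  qed (use \<mu> in simp)
  also have "\<dots> = h * norm (z - s)" by (simp add: h_def algebra_simps add_divide_distrib)
  finally have ps: "norm (p - s) \<le> h * norm (z - s)" .
  have "norm (D' x - D x) \<le> w * (P + Q * norm (x - s))" by (rule D')
  also have "\<dots> \<le> w * ((P + Q * h) * r + Q * norm (x - p))"
  proof (rule mult_left_mono[OF _ w(1)])
    have "Q * norm (x - s) \<le> Q * (norm (x - p) + h * norm (z - s))"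
      using norm_triangle_ineq[of "x - p" "p - s"] ps PQ by (intro mult_left_mono) auto
    moreover have "P + Q * h * norm (z - s) \<le> (P + Q * h) * r"
      using PQ h by (simp add: r_def algebra_simps)
    ultimately show "P + Q * norm (x - s) \<le> (P + Q * h) * r + Q * norm (x - p)"
      by (simp add: algebra_simps)
  qed
  also have "\<dots> \<le> w * ((P + Q * h) * r) + W * (Q * norm (x - p))"
    using w(2) PQ by (simp add: distrib_left mult_right_mono)
  finally have err_x: "norm (D' x - D x) \<le> w * ((P + Q * h) * r) + W * (Q * norm (x - p))" .
  have lip: "norm (D p - D x) \<le> k * norm (x - p)"
    using lipschitz_onD[OF D, of p "x"] by (simp add: dist_norm norm_minus_commute)
  have "x + \<gamma> *\<^sub>R (D' z - D' x) - (p + \<gamma> *\<^sub>R (D z - D p)) = (x - p)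
      + \<gamma> *\<^sub>R ((D' z - D z) + (D p - D x) - (D' x - D x))"
    by (simp add: algebra_simps)
  then have "norm (x + \<gamma> *\<^sub>R (D' z - D' x) - (p + \<gamma> *\<^sub>R (D z - D p))) \<le> norm (x - p)
      + \<gamma> * norm ((D' z - D z) + (D p - D x) - (D' x - D x))"
    using norm_triangle_ineq g(1) by (metis abs_of_pos norm_scaleR)
  also have "\<dots> \<le> norm (x - p)
      + g * norm ((D' z - D z) + (D p - D x) - (D' x - D x))"
    by (intro add_left_mono gn) auto
  also have "norm ((D' z - D z) + (D p - D x) - (D' x - D x))
      \<le> w * ((P + Q) * r) + k * norm (x - p)
        + (w * ((P + Q * h) * r) + W * (Q * norm (x - p)))"
    using err_z err_x lip norm_triangle_ineq[of "D' z - D z" "D p - D x"]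
      norm_triangle_ineq4[of "(D' z - D z) + (D p - D x)" "D' x - D x"]
    by linarith
  also have "norm (x - p) + g * (w * ((P + Q) * r) + k * norm (x - p)
        + (w * ((P + Q * h) * r) + W * (Q * norm (x - p))))
      = norm (x - p) * (1 + g * k + g * Q * W)
        + w * (g * (P + Q) + g * (P + Q * h)) * r"
    by (simp add: algebra_simps)
  also have "\<dots> \<le> (w * (G * (P + Q)) * r) * (1 + g * k + g * Q * W)
        + w * (g * (P + Q) + g * (P + Q * h)) * r"
    using d g k PQ W0 by (intro add_right_mono mult_right_mono) auto
  also have "\<dots> = w * M * r" by (simp add: M_def G_def[symmetric] algebra_simps)
  finally show "norm ((x + \<gamma> *\<^sub>R (D' z - D' x)) - (p + \<gamma> *\<^sub>R (D z - D p)))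
      \<le> w * M * (1 + norm (z - s))"
    using g0 by (simp add: r_def mult_left_mono)
qed

text \<open>
  The resolvent points \<open>p\<close> have the same weak limit as \<open>z\<close>, and the values \<open>q n + T (p n)\<close> of
  \<open>A + T\<close> at these points tend to zero, since they differ from \<open>(z - p)/\<gamma>\<close> by increments of \<open>T\<close>
  between \<open>p\<close> and \<open>z\<close>.
\<close>

lemma weak_limit_of_resolvent_points:
  fixes A :: "'h::{real_inner, complete_space} \<Rightarrow> 'h set"
  assumes A: "maximally_rho_monotone \<rho> A" and F: "f-lipschitz_on UNIV T"
    and mono: "\<And>x u y v. u \<in> A x \<Longrightarrow> v \<in> A y \<Longrightarrow> 0 \<le> (x - y) \<bullet> ((u + T x) - (v + T y))"
    and \<epsilon>: "0 < \<epsilon>" and \<gamma>: "\<And>n. \<epsilon> \<le> \<gamma> n"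
    and p: "\<And>n. (1 / \<gamma> n) *\<^sub>R (z n - \<gamma> n *\<^sub>R T (z n) - p n) \<in> A (p n)"
    and diff: "(\<lambda>n. p n - z n) \<longlonglongrightarrow> 0"
    and weak: "converges_weakly z s" and M: "\<And>n. norm (z n) \<le> M"
  shows "- T s \<in> A s"
proof -
  have \<gamma>_pos: "0 < \<gamma> n" for n using \<epsilon> \<gamma>[of n] by linarith
  define q where "q = (\<lambda>n. (1 / \<gamma> n) *\<^sub>R (z n - \<gamma> n *\<^sub>R T (z n) - p n))"
  have q: "q n \<in> A (p n)" for n
    using p by (simp add: q_def)
  obtain N where N: "\<And>n. norm (p n - z n) \<le> N"
    using convergent_imp_Bseq[OF convergentI[OF diff]] unfolding Bseq_def by blast
  have bound: "norm (p n) \<le> N + M" for n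
    using N[of n] M[of n] norm_triangle_ineq[of "p n - z n" "z n"] by simp
  have pw: "converges_weakly p s"
    unfolding converges_weakly_def
  proof
    fix v
    have "(\<lambda>n. z n \<bullet> v + (p n - z n) \<bullet> v) \<longlonglongrightarrow> s \<bullet> v + 0 \<bullet> v"
      using weak by (intro tendsto_add tendsto_inner[OF diff tendsto_const]) (simp add: converges_weakly_def)
    then show "(\<lambda>n. p n \<bullet> v) \<longlonglongrightarrow> s \<bullet> v" by (simp add: inner_diff_left)
  qed
  have res: "(\<lambda>n. q n + T (p n)) \<longlonglongrightarrow> 0"
  proof (rule Lim_null_comparison)
    have "norm (q n + T (p n)) \<le> (1 / \<epsilon> + f) * norm (p n - z n)" for n
    proof -
      have "q n + T (p n) = (1 / \<gamma> n) *\<^sub>R (z n - p n) + (T (p n) - T (z n))"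
        using \<gamma>_pos[of n] by (simp add: q_def algebra_simps)
      then have "norm (q n + T (p n)) \<le> norm ((1 / \<gamma> n) *\<^sub>R (z n - p n)) + norm (T (p n) - T (z n))"
        by (metis norm_triangle_ineq)
      also have "norm ((1 / \<gamma> n) *\<^sub>R (z n - p n)) \<le> (1 / \<epsilon>) * norm (p n - z n)"
        using \<gamma>_pos[of n] \<gamma>[of n] \<epsilon>
        by (simp add: norm_minus_commute divide_left_mono)
      also have "norm (T (p n) - T (z n)) \<le> f * norm (p n - z n)"
        using lipschitz_onD[OF F, of "p n" "z n"] by (simp add: dist_norm)
      finally show ?thesis by (simp add: algebra_simps)
    qed
    then show "\<forall>\<^sub>F n in sequentially. norm (q n + T (p n)) \<le> (1 / \<epsilon> + f) * norm (p n - z n)"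
      by simp
    show "(\<lambda>n. (1 / \<epsilon> + f) * norm (p n - z n)) \<longlonglongrightarrow> 0"
      using tendsto_mult_left[OF tendsto_norm_zero[OF diff], of "1 / \<epsilon> + f"] by simp
  qed
  show ?thesis by (rule weak_limit_of_approximate_zeros[OF A F mono q res pw bound])
qed

lemma strongly_monotone_zero_unique:
  assumes mono: "\<And>x u y v. u \<in> A x \<Longrightarrow> v \<in> A y
      \<Longrightarrow> \<sigma> * (norm (x - y))\<^sup>2 \<le> (x - y) \<bullet> ((u + D x) - (v + D y))"
    and \<sigma>: "0 < \<sigma>" and C: "cocoercive \<beta> C" "0 < \<beta>"
    and s: "- (C s + D s) \<in> A s" and t: "- (C t + D t) \<in> A t"
  shows "s = t"
proof -
  have "\<sigma> * (norm (s - t))\<^sup>2 \<le> (s - t) \<bullet> ((- (C s + D s) + D s) - (- (C t + D t) + D t))"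
    by (rule mono[OF s t])
  also have "\<dots> = - ((s - t) \<bullet> (C s - C t))" by (simp add: algebra_simps)
  also have "\<dots> \<le> 0"
    using cocoercive_monotone[OF C] by simp
  finally have "(norm (s - t))\<^sup>2 \<le> 0" using \<sigma> by (simp add: mult_le_0_iff)
  then show ?thesis by simp
qed

text \<open>
  The constants \<open>\<mu>\<close> and \<open>\<delta>\<close> abstract what the step size bound is used for. The error of \<open>D' n\<close> may
  grow with the argument, as it does for an operator that is composed with a perturbed linear map.
  When \<open>\<sigma> > 0\<close>, the two decrease terms of the exact step together dominate a multiple of
  \<open>\<parallel>z - s\<parallel>\<^sup>2\<close>, because \<open>\<parallel>z - s\<parallel>\<^sup>2 \<le> 2\<parallel>p - z\<parallel>\<^sup>2 + 2\<parallel>p - s\<parallel>\<^sup>2\<close>: the exact step contracts towards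
  \<open>s\<close>.
\<close>

lemma perturbed_fbhf_convergence:
  fixes A :: "'h::{real_inner, complete_space} \<Rightarrow> 'h set"
  assumes max: "maximally_rho_monotone \<rho> A"
    and mono: "\<And>x u y v. u \<in> A x \<Longrightarrow> v \<in> A y
      \<Longrightarrow> \<sigma> * (norm (x - y))\<^sup>2 \<le> (x - y) \<bullet> ((u + D x) - (v + D y))" and \<sigma>: "0 \<le> \<sigma>"
    and C: "cocoercive \<beta> C" "0 < \<beta>" and D: "k-lipschitz_on UNIV D"
    and \<epsilon>: "0 < \<epsilon>" and \<gamma>: "\<And>n. \<epsilon> \<le> \<gamma> n" "\<And>n. \<gamma> n \<le> g"
    and \<mu>: "0 < \<mu>" "\<And>n. \<mu> \<le> 1 + \<gamma> n * \<rho>"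
    and \<delta>: "0 < \<delta>" "\<And>n. \<delta> \<le> 1 - (\<gamma> n)\<^sup>2 * k\<^sup>2 - \<gamma> n / (2 * \<beta>)"
    and \<omega>: "\<And>n. 0 \<le> \<omega> n" "summable \<omega>" and PQ: "0 \<le> P" "0 \<le> Q"
    and D': "\<And>n v. norm (D' n v - D v) \<le> \<omega> n * (P + Q * norm v)"
    and x: "\<And>n. (1 / \<gamma> n) *\<^sub>R (z n - \<gamma> n *\<^sub>R (C (z n) + D' n (z n)) - x n) \<in> A (x n)"
    and z: "\<And>n. z (Suc n) = x n + \<gamma> n *\<^sub>R (D' n (z n) - D' n (x n))"
  defines "Z \<equiv> {s. - (C s + D s) \<in> A s}"
  assumes ne: "Z \<noteq> {}"
  shows "\<exists>s\<in>Z. converges_weakly z s"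
    and "0 < \<sigma> \<Longrightarrow> 0 \<le> \<eta> \<Longrightarrow> \<eta> < 1 \<Longrightarrow> (\<And>n. \<omega> n = \<omega> 0 * \<eta> ^ n)
      \<Longrightarrow> \<exists>s. Z = {s} \<and> converges_linearly z s"
proof -
  have \<gamma>_pos: "0 < \<gamma> n" for n using \<epsilon> \<gamma>(1)[of n] by linarith
  have A: "rho_monotone \<rho> A" using max by (simp add: maximally_rho_monotone_def)
  have F: "(1 / \<beta> + k)-lipschitz_on UNIV (\<lambda>v. C v + D v)"
    by (intro lipschitz_on_add cocoercive_lipschitz C D)
  have "\<exists>p. (1 / \<gamma> n) *\<^sub>R (z n - \<gamma> n *\<^sub>R (C (z n) + D (z n)) - p) \<in> A p" for n
  proof -
    have "0 < 1 + \<gamma> n * \<rho>" using \<mu>(1) \<mu>(2)[of n] by linarith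
    then show ?thesis using minty[OF max \<gamma>_pos[of n]] by metis
  qed
  then obtain p where p: "\<And>n. (1 / \<gamma> n) *\<^sub>R (z n - \<gamma> n *\<^sub>R (C (z n) + D (z n)) - p n) \<in> A (p n)"
    by metis
  define v where "v = (\<lambda>n. p n + \<gamma> n *\<^sub>R (D (z n) - D (p n)))"
  have decrease: "(norm (v n - s))\<^sup>2 \<le> (norm (z n - s))\<^sup>2
      - (\<delta> * (norm (p n - z n))\<^sup>2 + 2 * \<epsilon> * \<sigma> * (norm (p n - s))\<^sup>2)" if "s \<in> Z" for s n
  proof -
    have "(norm (v n - s))\<^sup>2 \<le> (norm (z n - s))\<^sup>2
        - (1 - (\<gamma> n)\<^sup>2 * k\<^sup>2 - \<gamma> n / (2 * \<beta>)) * (norm (p n - z n))\<^sup>2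
        - 2 * \<gamma> n * \<sigma> * (norm (p n - s))\<^sup>2"
      unfolding v_def using that
      by (intro forward_backward_half_forward_step[where A = A and C = C and D = D]
          mono C D \<gamma>_pos p) (auto simp: Z_def)
    moreover have "\<delta> * (norm (p n - z n))\<^sup>2
        \<le> (1 - (\<gamma> n)\<^sup>2 * k\<^sup>2 - \<gamma> n / (2 * \<beta>)) * (norm (p n - z n))\<^sup>2"
      using \<delta>(2) by (intro mult_right_mono) auto
    moreover have "2 * \<epsilon> * \<sigma> * (norm (p n - s))\<^sup>2 \<le> 2 * \<gamma> n * \<sigma> * (norm (p n - s))\<^sup>2"
      using \<gamma>(1) \<sigma> by (intro mult_right_mono mult_left_mono) auto
    ultimately show ?thesis by linarith
  qed
  obtain W where W: "\<And>n. \<omega> n \<le> W"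
    using summable_imp_Bseq[OF \<omega>(2)] unfolding Bseq_def real_norm_def by (meson abs_le_D1)
  have error: "\<exists>M\<ge>0. \<forall>n. norm (z (Suc n) - v n) \<le> \<omega> n * M * (1 + norm (z n - s))" if "s \<in> Z" for s
  proof -
    \<comment> \<open>recentre the bound on the perturbation at \<open>s\<close>\<close>
    have D's: "norm (D' n a - D a) \<le> \<omega> n * ((P + Q * norm s) + Q * norm (a - s))" for n a
    proof -
      have "Q * norm a \<le> Q * (norm (a - s) + norm s)"
        using norm_triangle_ineq[of "a - s" s] PQ by (intro mult_left_mono) auto
      then have "\<omega> n * (P + Q * norm a) \<le> \<omega> n * ((P + Q * norm s) + Q * norm (a - s))"
        using \<omega>(1) by (intro mult_left_mono) (auto simp: algebra_simps)
      then show ?thesis using D'[of n a] by linarith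
    qed
    have P: "0 \<le> P + Q * norm s" using PQ by simp
    have s: "- (C s + D s) \<in> A s" using that by (simp add: Z_def)
    note err = perturbed_step_error[OF A F D \<gamma>_pos \<gamma>(2) \<mu> \<omega>(1) W P PQ(2) D's s x p]
    show ?thesis unfolding z v_def using err by blast
  qed
  have fejer: "convergent (\<lambda>n. (norm (z n - s))\<^sup>2)" "(\<lambda>n. \<delta> * (norm (p n - z n))\<^sup>2) \<longlonglongrightarrow> 0"
    "\<exists>M. \<forall>n. norm (z n - s) \<le> M" if s: "s \<in> Z" for s
  proof -
    obtain M where M: "0 \<le> M" "\<And>n. norm (z (Suc n) - v n) \<le> \<omega> n * M * (1 + norm (z n - s))"
      using error[OF s] by blast
    have "(norm (v n - s))\<^sup>2 \<le> (norm (z n - s))\<^sup>2 - \<delta> * (norm (p n - z n))\<^sup>2" for n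
    proof -
      have "0 \<le> 2 * \<epsilon> * \<sigma> * (norm (p n - s))\<^sup>2" using \<epsilon> \<sigma> by simp
      with decrease[OF s, of n] show ?thesis by linarith
    qed
    from quasi_fejer[OF summable_mult2[OF \<omega>(2)] _ _ this M(2)] \<omega>(1) M(1) \<delta>(1)
    show "convergent (\<lambda>n. (norm (z n - s))\<^sup>2)" "(\<lambda>n. \<delta> * (norm (p n - z n))\<^sup>2) \<longlonglongrightarrow> 0"
      "\<exists>M. \<forall>n. norm (z n - s) \<le> M" by simp_all
  qed
  obtain s0 where s0: "s0 \<in> Z" using ne by blast
  have diff: "(\<lambda>n. p n - z n) \<longlonglongrightarrow> 0"
  proof (rule tendsto_norm_zero_cancel)
    have "(\<lambda>n. sqrt (1 / \<delta> * (\<delta> * (norm (p n - z n))\<^sup>2))) \<longlonglongrightarrow> sqrt (1 / \<delta> * 0)"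
      by (intro tendsto_real_sqrt tendsto_mult_left fejer(2)[OF s0])
    then show "(\<lambda>n. norm (p n - z n)) \<longlonglongrightarrow> 0" using \<delta>(1) by simp
  qed
  obtain M0 where M0: "\<And>n. norm (z n - s0) \<le> M0" using fejer(3)[OF s0] by blast
  have M: "norm (z n) \<le> M0 + norm s0" for n
    using M0[of n] norm_triangle_ineq[of "z n - s0" s0] by simp
  have mono_sum: "0 \<le> (a - b) \<bullet> ((u + (C a + D a)) - (w + (C b + D b)))"
    if "u \<in> A a" "w \<in> A b" for a b u w
  proof -
    have "0 \<le> \<sigma> * (norm (a - b))\<^sup>2" using \<sigma> by simp
    also have "\<dots> \<le> (a - b) \<bullet> ((u + D a) - (w + D b))" by (rule mono[OF that])
    finally have "0 \<le> (a - b) \<bullet> ((u + D a) - (w + D b))" .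
    moreover have "0 \<le> (a - b) \<bullet> (C a - C b)" by (rule cocoercive_monotone[OF C])
    moreover have "(a - b) \<bullet> ((u + (C a + D a)) - (w + (C b + D b)))
        = (a - b) \<bullet> ((u + D a) - (w + D b)) + (a - b) \<bullet> (C a - C b)"
      by (simp add: algebra_simps)
    ultimately show ?thesis by linarith
  qed
  show "\<exists>s\<in>Z. converges_weakly z s"
  proof (rule opial_weak_convergence[OF ne fejer(1)])
    fix r :: "nat \<Rightarrow> nat" and s assume r: "strict_mono r" and "converges_weakly (z \<circ> r) s"
    then have weak: "converges_weakly (\<lambda>n. z (r n)) s" by (simp add: o_def)
    have "(\<lambda>n. p (r n) - z (r n)) \<longlonglongrightarrow> 0"
      using LIMSEQ_subseq_LIMSEQ[OF diff r] by (simp add: o_def)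
    from weak_limit_of_resolvent_points[OF max F mono_sum \<epsilon> \<gamma>(1) p this weak M]
    show "s \<in> Z" by (simp add: Z_def)
  qed
  assume \<sigma>: "0 < \<sigma>" and \<eta>: "0 \<le> \<eta>" "\<eta> < 1" "\<And>n. \<omega> n = \<omega> 0 * \<eta> ^ n"
  have "converges_linearly z s" if s: "s \<in> Z" for s
  proof -
    obtain M where M: "0 \<le> M" "\<And>n. norm (z (Suc n) - v n) \<le> \<omega> n * M * (1 + norm (z n - s))"
      using error[OF s] by blast
    obtain H where H: "\<And>n. norm (z n - s) \<le> H" using fejer(3)[OF s] by blast
    have H0: "0 \<le> H" using H[of 0] norm_ge_zero order_trans by blast
    define \<tau> where "\<tau> = min \<delta> (2 * \<epsilon> * \<sigma>) / 2"
    have \<tau>: "0 < \<tau>" "2 * \<tau> \<le> \<delta>" "2 * \<tau> \<le> 2 * \<epsilon> * \<sigma>"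
      using \<delta>(1) \<epsilon> \<sigma> by (auto simp: \<tau>_def min_def)
    \<comment> \<open>the maximum only keeps the root meaningful; \<open>1 - \<tau>\<close> may be negative here\<close>
    define q where "q = sqrt (max 0 (1 - \<tau>))"
    have q: "0 \<le> q" "q < 1" "1 - \<tau> \<le> q\<^sup>2" using \<tau>(1) by (auto simp: q_def)
    have contract: "norm (v n - s) \<le> q * norm (z n - s)" for n
    proof -
      let ?p = "p n"
      have "(norm (z n - s))\<^sup>2 \<le> (norm (?p - z n) + norm (?p - s))\<^sup>2"
        using norm_triangle_ineq4[of "?p - s" "?p - z n"] by (intro power_mono) auto
      also have "\<dots> \<le> 2 * (norm (?p - z n))\<^sup>2 + 2 * (norm (?p - s))\<^sup>2"
        using zero_le_power2[of "norm (?p - z n) - norm (?p - s)"]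
        by (simp add: power2_diff power2_sum)
      finally have "\<tau> * (norm (z n - s))\<^sup>2 \<le> \<tau> * (2 * (norm (?p - z n))\<^sup>2 + 2 * (norm (?p - s))\<^sup>2)"
        using \<tau>(1) by (intro mult_left_mono) auto
      also have "\<dots> = 2 * \<tau> * (norm (?p - z n))\<^sup>2 + 2 * \<tau> * (norm (?p - s))\<^sup>2"
        by (simp add: algebra_simps)
      also have "\<dots> \<le> \<delta> * (norm (?p - z n))\<^sup>2 + 2 * \<epsilon> * \<sigma> * (norm (?p - s))\<^sup>2"
        using \<tau> by (intro add_mono mult_right_mono) auto
      finally have "(norm (v n - s))\<^sup>2 \<le> (1 - \<tau>) * (norm (z n - s))\<^sup>2"
        using decrease[OF s, of n] by (simp add: left_diff_distrib)
      also have "\<dots> \<le> q\<^sup>2 * (norm (z n - s))\<^sup>2"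
        using q(3) by (intro mult_right_mono) auto
      finally have "(norm (v n - s))\<^sup>2 \<le> (q * norm (z n - s))\<^sup>2"
        by (simp add: power_mult_distrib)
      then show ?thesis by (rule power2_le_imp_le) (use q(1) in simp)
    qed
    have "norm (z (Suc n) - s) \<le> q * norm (z n - s) + (\<omega> 0 * M * (1 + H)) * \<eta> ^ n" for n
    proof -
      have "\<omega> n * M * (1 + norm (z n - s)) \<le> \<omega> n * M * (1 + H)"
        using H[of n] \<omega>(1) M(1) by (intro mult_left_mono) auto
      also have "\<dots> = (\<omega> 0 * M * (1 + H)) * \<eta> ^ n" by (subst \<eta>(3)) (simp add: mult_ac)
      finally show ?thesis
        using M(2)[of n] contract[of n] norm_triangle_ineq[of "z (Suc n) - v n" "v n - s"]
        by simp
    qed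
    from geometric_perturbation_decay[where a = "\<lambda>n. norm (z n - s)", OF q(1,2) \<eta>(1,2) _ _ this]
    show ?thesis unfolding converges_linearly_def using \<omega>(1) M(1) H0 by simp
  qed
  moreover have "t = s0" if "t \<in> Z" for t
    using that s0 by (intro strongly_monotone_zero_unique[OF mono \<sigma> C]) (auto simp: Z_def)
  ultimately show "\<exists>s. Z = {s} \<and> converges_linearly z s"
    using s0 by blast
qed

section \<open>The operator \<open>D\<^sub>M\<close> and its constants\<close>

lemma Lip_lipschitz_on:
  assumes "k-lipschitz_on UNIV T"
  shows "(Lip T)-lipschitz_on UNIV T"
proof (rule lipschitz_onI)
  let ?S = "{k. k-lipschitz_on UNIV T}"
  show "0 \<le> Lip T"
    unfolding Lip_def using assms by (intro cInf_greatest) (auto dest: lipschitz_on_nonneg)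
  fix x y
  show "dist (T x) (T y) \<le> Lip T * dist x y"
  proof (cases "x = y")
    case False
    have "dist (T x) (T y) / dist x y \<le> Lip T"
      unfolding Lip_def
    proof (rule cInf_greatest)
      show "?S \<noteq> {}" using assms by auto
      show "dist (T x) (T y) / dist x y \<le> l" if "l \<in> ?S" for l
        using lipschitz_onD[of l UNIV T x y] that False by (simp add: field_simps)
    qed
    with False show ?thesis by (simp add: field_simps)
  qed simp
qed

lemma bounded_linear_lipschitz_compose:
  assumes "bounded_linear M" "l-lipschitz_on UNIV f"
  shows "\<exists>k. k-lipschitz_on UNIV (\<lambda>x. M (f x))"
proof -
  obtain K where "0 \<le> K" "\<And>x. norm (M x) \<le> norm x * K"
    using bounded_linear.nonneg_bounded[OF assms(1)] by metis
  then have "K-lipschitz_on UNIV M"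
    by (intro lipschitz_onI) (auto simp: dist_norm mult.commute
        simp flip: linear_diff[OF bounded_linear.linear[OF assms(1)]])
  then have "K-lipschitz_on (f ` UNIV) M" by (rule lipschitz_on_subset) simp
  with assms(2) show ?thesis by (intro exI) (rule lipschitz_on_compose2)
qed

lemma mismatch_inner_lipschitz:
  fixes L :: "'h::real_normed_vector \<Rightarrow>\<^sub>L 'g::real_normed_vector"
  assumes "0 \<le> \<alpha>" "\<zeta>-lipschitz_on UNIV B"
  shows "((\<alpha> + \<zeta>) * norm L)-lipschitz_on UNIV (\<lambda>x. \<alpha> *\<^sub>R L x + B (L x))"
proof (rule lipschitz_onI)
  have \<zeta>: "0 \<le> \<zeta>" using assms(2) by (rule lipschitz_on_nonneg)
  then show "0 \<le> (\<alpha> + \<zeta>) * norm L" using assms(1) by simp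
  fix x y
  have L: "norm (L x - L y) \<le> norm L * norm (x - y)"
    using norm_blinfun[of L "x - y"] by (simp add: blinfun.diff_right)
  have "dist (\<alpha> *\<^sub>R L x + B (L x)) (\<alpha> *\<^sub>R L y + B (L y))
      = norm (\<alpha> *\<^sub>R (L x - L y) + (B (L x) - B (L y)))"
    by (simp add: dist_norm algebra_simps)
  also have "\<dots> \<le> \<alpha> * norm (L x - L y) + \<zeta> * norm (L x - L y)"
    using norm_triangle_ineq[of "\<alpha> *\<^sub>R (L x - L y)" "B (L x) - B (L y)"] assms(1)
      lipschitz_onD[OF assms(2), of "L x" "L y"] by (simp add: dist_norm)
  also have "\<dots> = (\<alpha> + \<zeta>) * norm (L x - L y)" by (simp add: algebra_simps)
  also have "\<dots> \<le> (\<alpha> + \<zeta>) * (norm L * norm (x - y))"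
    using L \<zeta> assms(1) by (intro mult_left_mono) auto
  finally show "dist (\<alpha> *\<^sub>R L x + B (L x)) (\<alpha> *\<^sub>R L y + B (L y)) \<le> (\<alpha> + \<zeta>) * norm L * dist x y"
    by (simp add: dist_norm)
qed

text \<open>
  The offset \<open>c\<close> only translates \<open>D\<^sub>M\<close>, hence does not affect its Lipschitz constant \<open>\<kappa>\<^sub>M\<close>.
\<close>

lemma mismatch_op_eq:
  fixes M :: "'g::real_normed_vector \<Rightarrow>\<^sub>L 'h::real_normed_vector"
  shows "mismatch_op \<alpha> L B c M x = M (\<alpha> *\<^sub>R L x + B (L x)) - \<alpha> *\<^sub>R M c"
  by (simp add: mismatch_op_def blinfun.diff_right blinfun.add_right blinfun.scaleR_right
      scaleR_diff_right)

lemma mismatch_op_lipschitz: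
  fixes M :: "'g::real_normed_vector \<Rightarrow>\<^sub>L 'h::real_normed_vector"
  assumes "0 \<le> \<alpha>" "\<zeta>-lipschitz_on UNIV B"
  shows "(kappa \<alpha> L B M)-lipschitz_on UNIV (mismatch_op \<alpha> L B c M)"
proof -
  obtain k where "k-lipschitz_on UNIV (\<lambda>x. M (\<alpha> *\<^sub>R L x + B (L x)))"
    using bounded_linear_lipschitz_compose[OF blinfun.bounded_linear_right mismatch_inner_lipschitz[OF assms]] by blast
  then have "(kappa \<alpha> L B M)-lipschitz_on UNIV (\<lambda>x. M (\<alpha> *\<^sub>R L x + B (L x)))"
    unfolding kappa_def by (rule Lip_lipschitz_on)
  then show ?thesis
    by (simp add: lipschitz_on_def mismatch_op_eq dist_norm)
qed

text \<open>
  The bound has to grow with the argument, since \<open>M'\<close> is close to \<open>M\<close> only in operator norm.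
\<close>

lemma mismatch_op_perturbation:
  fixes M M' :: "'g::real_normed_vector \<Rightarrow>\<^sub>L 'h::real_normed_vector"
  assumes "0 \<le> \<alpha>" "\<zeta>-lipschitz_on UNIV B" "norm (M' - M) \<le> w"
  shows "norm (mismatch_op \<alpha> L B c M' x - mismatch_op \<alpha> L B c M x)
    \<le> w * (norm (B 0 - \<alpha> *\<^sub>R c) + (\<alpha> + \<zeta>) * norm L * norm x)"
proof -
  let ?f = "\<lambda>x. \<alpha> *\<^sub>R L x + B (L x)"
  have w: "0 \<le> w" using assms(3) norm_ge_zero order_trans by blast
  have "mismatch_op \<alpha> L B c M' x - mismatch_op \<alpha> L B c M x = (M' - M) (?f x - \<alpha> *\<^sub>R c)"
    by (simp add: mismatch_op_eq blinfun.diff_left blinfun.diff_right blinfun.scaleR_right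
        scaleR_diff_right)
  then have "norm (mismatch_op \<alpha> L B c M' x - mismatch_op \<alpha> L B c M x)
      \<le> norm (M' - M) * norm (?f x - \<alpha> *\<^sub>R c)"
    by (simp add: norm_blinfun)
  also have "\<dots> \<le> w * norm (?f x - \<alpha> *\<^sub>R c)" using assms(3) by (intro mult_right_mono) auto
  also have "\<dots> \<le> w * (norm (B 0 - \<alpha> *\<^sub>R c) + (\<alpha> + \<zeta>) * norm L * norm x)"
  proof (rule mult_left_mono[OF _ w])
    have "norm (?f x - ?f 0) \<le> (\<alpha> + \<zeta>) * norm L * norm x"
      using lipschitz_onD[OF mismatch_inner_lipschitz[OF assms(1,2)], of x 0 L] by (simp add: dist_norm)
    then show "norm (?f x - \<alpha> *\<^sub>R c) \<le> norm (B 0 - \<alpha> *\<^sub>R c) + (\<alpha> + \<zeta>) * norm L * norm x"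
      using norm_triangle_ineq[of "?f x - ?f 0" "B 0 - \<alpha> *\<^sub>R c"] by simp
  qed
  finally show ?thesis .
qed

text \<open>
  Homogeneity extends the bound from the unit sphere. The set is bounded below by \<open>-\<parallel>K\<parallel>\<parallel>L\<parallel>\<close>,
  without which the real infimum would be unspecified.
\<close>

lemma lambda_min_le:
  fixes L :: "'h::real_inner \<Rightarrow>\<^sub>L 'g::real_normed_vector"
  shows "lambda_min L K * (norm x)\<^sup>2 \<le> x \<bullet> K (L x)"
proof (cases "x = 0")
  case False
  let ?S = "{x \<bullet> K (L x) | x. norm x = 1}"
  have "bdd_below ?S"
  proof (rule bdd_belowI[of _ "- (norm K * norm L)"], clarify)
    fix v :: 'h assume v: "norm v = 1"
    have "norm (K (L v)) \<le> norm K * (norm L * norm v)"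
      by (intro order_trans[OF norm_blinfun] mult_left_mono norm_blinfun) auto
    with v show "- (norm K * norm L) \<le> v \<bullet> K (L v)"
      using Cauchy_Schwarz_ineq2[of v "K (L v)"] by simp
  qed
  moreover have "sgn x \<bullet> K (L (sgn x)) \<in> ?S" using False by (auto simp: norm_sgn)
  ultimately have "lambda_min L K \<le> sgn x \<bullet> K (L (sgn x))"
    unfolding lambda_min_def by (intro cInf_lower)
  also have "\<dots> = (x \<bullet> K (L x)) / (norm x)\<^sup>2"
    by (simp add: sgn_div_norm blinfun.scaleR_right power2_eq_square divide_inverse)
  finally show ?thesis using False by (simp add: field_simps)
qed simp

text \<open>
  The splitting \<open>K = L\<^sup>* - (L\<^sup>* - K)\<close> in the term \<open>KBL\<close>: the operator \<open>L\<^sup>*BL\<close> is monotone, and the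
  mismatch \<open>(L\<^sup>* - K)BL\<close> loses at most its Lipschitz constant. The linear term \<open>\<alpha>KL\<close> contributes
  \<open>\<alpha>\<lambda>\<^sub>m\<^sub>i\<^sub>n\<close>.
\<close>

lemma mismatch_op_monotone:
  fixes L :: "'h::{real_inner, complete_space} \<Rightarrow>\<^sub>L 'g::real_inner"
  assumes B: "monotone_single B" and lip: "\<zeta>-lipschitz_on UNIV B" and \<alpha>: "0 \<le> \<alpha>"
  shows "(rho_hat \<rho> \<alpha> L B K - \<rho>) * (norm (x - y))\<^sup>2
    \<le> (x - y) \<bullet> (mismatch_op \<alpha> L B c K x - mismatch_op \<alpha> L B c K y)"
proof -
  let ?N = "\<lambda>v. adjoint (blinfun_apply L) v - K v"
  let ?b = "B (L x) - B (L y)"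
  have N: "bounded_linear ?N"
    by (intro bounded_linear_sub bounded_linear_adjoint blinfun.bounded_linear_right)
  have "\<exists>l. l-lipschitz_on UNIV (\<lambda>v. B (L v))"
  proof -
    obtain l where "l-lipschitz_on UNIV (\<lambda>v. L v)"
      using bounded_linear_lipschitz_compose[OF blinfun.bounded_linear_right lipschitz_on_id] by auto
    then show ?thesis using lipschitz_on_compose2 lip lipschitz_on_subset by blast
  qed
  then obtain l where "l-lipschitz_on UNIV (\<lambda>v. ?N (B (L v)))"
    using bounded_linear_lipschitz_compose[OF N] by blast
  then have "(zeta_tilde L B ?N)-lipschitz_on UNIV (\<lambda>v. ?N (B (L v)))"
    unfolding zeta_tilde_def by (rule Lip_lipschitz_on)
  from lipschitz_onD[OF this, of x y]
  have "norm (?N ?b) \<le> zeta_tilde L B ?N * norm (x - y)"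
    using bounded_linear.linear[OF N] by (simp add: dist_norm linear_diff[of ?N])
  then have "norm (x - y) * norm (?N ?b) \<le> norm (x - y) * (zeta_tilde L B ?N * norm (x - y))"
    by (intro mult_left_mono) auto
  then have "(x - y) \<bullet> ?N ?b \<le> zeta_tilde L B ?N * (norm (x - y))\<^sup>2"
    using norm_cauchy_schwarz[of "x - y" "?N ?b"] by (simp add: power2_eq_square mult_ac)
  moreover have "0 \<le> (x - y) \<bullet> adjoint (blinfun_apply L) ?b"
    using B by (simp add: monotone_single_def blinfun.diff_right flip: adjoint_inner)
  moreover have "\<alpha> * (lambda_min L K * (norm (x - y))\<^sup>2) \<le> \<alpha> * ((x - y) \<bullet> K (L (x - y)))"
    using \<alpha> by (intro mult_left_mono lambda_min_le)
  moreover have "(x - y) \<bullet> (mismatch_op \<alpha> L B c K x - mismatch_op \<alpha> L B c K y)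
      = \<alpha> * ((x - y) \<bullet> K (L (x - y))) + (x - y) \<bullet> adjoint (blinfun_apply L) ?b - (x - y) \<bullet> ?N ?b"
    by (simp add: mismatch_op_eq blinfun.diff_right blinfun.add_right blinfun.scaleR_right
        inner_diff_right inner_add_right algebra_simps)
  ultimately show ?thesis by (simp add: rho_hat_def algebra_simps)
qed

lemma zer_sum_iff: "s \<in> zer (add_op (add_op A C) D) \<longleftrightarrow> - (C s + D s) \<in> A s"
proof
  assume "s \<in> zer (add_op (add_op A C) D)"
  then obtain a where "a \<in> A s" "a + C s + D s = 0"
    by (auto simp: zer_def add_op_def)
  then show "- (C s + D s) \<in> A s" by (metis add.assoc eq_neg_iff_add_eq_0)
next
  assume "- (C s + D s) \<in> A s"
  then show "s \<in> zer (add_op (add_op A C) D)"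
    by (force simp: zer_def add_op_def)
qed

section \<open>The mismatched algorithm\<close>

theorem theorem4p5:
  fixes A :: "'h::{real_inner, complete_space} \<Rightarrow> 'h set"
    and C :: "'h \<Rightarrow> 'h"
    and B :: "'g::{real_inner, complete_space} \<Rightarrow> 'g"
    and L :: "'h \<Rightarrow>\<^sub>L 'g" and K :: "'g \<Rightarrow>\<^sub>L 'h" and Kn :: "nat \<Rightarrow> ('g \<Rightarrow>\<^sub>L 'h)"
    and c :: 'g
    and \<rho> \<beta> \<zeta> \<alpha> \<epsilon> \<chi>\<^sub>K :: real
    and \<omega> \<gamma> :: "nat \<Rightarrow> real"
    and D :: "('g \<Rightarrow>\<^sub>L 'h) \<Rightarrow> 'h \<Rightarrow> 'h"
    and S :: "'h set"
    and z u y x :: "nat \<Rightarrow> 'h"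
  defines "D \<equiv> \<lambda>M. mismatch_op \<alpha> L B c (blinfun_apply M)"
    and "S \<equiv> zer (add_op (add_op A C) (D K))"
    and "\<chi>\<^sub>K \<equiv> chi \<rho> \<beta> (kappa \<alpha> L B (blinfun_apply K))"
  assumes "maximally_rho_monotone \<rho> A"
    and "\<beta> > 0" and "cocoercive \<beta> C"
    and "monotone_single B" and "\<zeta> > 0" and "\<zeta>-lipschitz_on UNIV B"
    and "\<alpha> \<ge> 0"
    and "S \<noteq> {}"
    and "D K \<noteq> (\<lambda>_. 0)"
    and "rho_hat \<rho> \<alpha> L B K \<ge> 0"
    and "\<And>n. \<omega> n \<ge> 0" and "summable \<omega>" and "\<And>n. norm (Kn n - K) \<le> \<omega> n"
    and "0 < \<epsilon>" and "\<epsilon> < \<chi>\<^sub>K / 2"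
    and "\<And>n. \<gamma> n \<in> {\<epsilon>..\<chi>\<^sub>K - \<epsilon>}"
    and "\<And>n. u n = D (Kn n) (z n)"
    and "\<And>n. y n = z n - \<gamma> n *\<^sub>R (C (z n) + u n)"
    and "\<And>n. x n = the_elem (resolvent (scale_op (\<gamma> n) A) (y n))"
    and "\<And>n. z (Suc n) = x n + \<gamma> n *\<^sub>R (u n - D (Kn n) (x n))"
  shows "(\<exists>s \<in> S. converges_weakly z s) \<and>
         (rho_hat \<rho> \<alpha> L B K > 0 \<and> (\<exists>\<eta>. 0 \<le> \<eta> \<and> \<eta> < 1 \<and> (\<forall>n. \<omega> n = \<omega> 0 * \<eta> ^ n)) \<longrightarrow>
            (\<exists>s. S = {s} \<and> converges_linearly z s))"
proof -
  define \<kappa> where "\<kappa> = kappa \<alpha> L B (blinfun_apply K)"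
  define \<sigma> where "\<sigma> = rho_hat \<rho> \<alpha> L B K"
  define \<mu> where "\<mu> = (if \<rho> \<ge> 0 then 1 else - \<epsilon> * \<rho>)"
  have \<gamma>: "\<epsilon> \<le> \<gamma> n" "\<gamma> n \<le> chi \<rho> \<beta> \<kappa> - \<epsilon>" for n
    using assms(19)[of n] by (auto simp: assms(3) \<kappa>_def)
  have \<gamma>_pos: "0 < \<gamma> n" for n using \<gamma>(1)[of n] assms(17) by linarith
  have \<mu>: "0 < \<mu>" "\<mu> \<le> 1 + \<gamma> n * \<rho>" for n
    using chi_resolvent_margin[OF assms(17) \<gamma>_pos \<gamma>(2)] assms(17)
    by (auto simp: \<mu>_def mult_less_0_iff)
  have rho: "rho_monotone \<rho> A"
    using assms(4) by (simp add: maximally_rho_monotone_def)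
  have mono: "\<sigma> * (norm (a - b))\<^sup>2 \<le> (a - b) \<bullet> ((v + D K a) - (w + D K b))"
    if "v \<in> A a" "w \<in> A b" for a v b w
    using rho_monotoneD[OF rho that]
      mismatch_op_monotone[OF assms(7,9,10), where \<rho> = \<rho> and L = L and K = K and c = c
        and x = a and y = b]
    by (simp add: assms(1) \<sigma>_def algebra_simps)
  have lip: "\<kappa>-lipschitz_on UNIV (D K)"
    unfolding assms(1) \<kappa>_def by (rule mismatch_op_lipschitz[OF assms(10,9)])
  have error: "norm (D (Kn n) v - D K v)
      \<le> \<omega> n * (norm (B 0 - \<alpha> *\<^sub>R c) + (\<alpha> + \<zeta>) * norm L * norm v)" for n v
    unfolding assms(1) by (rule mismatch_op_perturbation[OF assms(10,9,16)])
  have PQ: "0 \<le> norm (B 0 - \<alpha> *\<^sub>R c)" "0 \<le> (\<alpha> + \<zeta>) * norm L"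
    using assms(8,10) by simp_all
  have x: "(1 / \<gamma> n) *\<^sub>R (z n - \<gamma> n *\<^sub>R (C (z n) + D (Kn n) (z n)) - x n) \<in> A (x n)" for n
  proof -
    have "0 < 1 + \<gamma> n * \<rho>" using \<mu>(1) \<mu>(2)[of n] by linarith
    from the_elem_resolvent[OF assms(4) \<gamma>_pos this assms(22)]
    show ?thesis by (simp add: assms(20,21))
  qed
  have z: "z (Suc n) = x n + \<gamma> n *\<^sub>R (D (Kn n) (z n) - D (Kn n) (x n))" for n
    by (simp add: assms(20,23))
  have \<delta>: "0 < \<epsilon> / (2 * \<beta>)" using assms(5,17) by simp
  have margin: "\<epsilon> / (2 * \<beta>) \<le> 1 - (\<gamma> n)\<^sup>2 * \<kappa>\<^sup>2 - \<gamma> n / (2 * \<beta>)" for n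
    by (rule chi_margin[OF assms(5,17) \<gamma>_pos \<gamma>(2)])
  have \<sigma>: "0 \<le> \<sigma>" using assms(13) by (simp add: \<sigma>_def)
  have S: "S = {s. - (C s + D K s) \<in> A s}"
    unfolding assms(2) using zer_sum_iff[of _ A C "D K"] by auto
  have ne: "{s. - (C s + D K s) \<in> A s} \<noteq> {}" using assms(11) unfolding S .
  note convergence = perturbed_fbhf_convergence[where A = A and C = C and D = "D K"
      and D' = "\<lambda>n. D (Kn n)", OF assms(4) mono \<sigma> assms(6,5) lip assms(17) \<gamma> \<mu> \<delta> margin
      assms(14,15) PQ error x z ne, folded S]
  have "\<exists>s\<in>S. converges_weakly z s" by (rule convergence(1))
  moreover have "\<exists>s. S = {s} \<and> converges_linearly z s"
    if "0 < rho_hat \<rho> \<alpha> L B K" and \<eta>: "0 \<le> \<eta>" "\<eta> < 1" "\<forall>n. \<omega> n = \<omega> 0 * \<eta> ^ n" for \<eta>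
  proof (rule convergence(2))
    show "0 < \<sigma>" using that(1) by (simp add: \<sigma>_def)
    show "\<omega> n = \<omega> 0 * \<eta> ^ n" for n using \<eta>(3) by blast
  qed (simp_all add: \<eta>(1,2))
  ultimately show ?thesis by blast
qed

end
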